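(* Let $A\in\mathbb{Z}^{m\times s}$ be a saturated matrix of rank $s-1$. Assume that, up to sign, $A$ has a unique minimal linear dependency $\mathbf{a}\in\ker_{\mathbb{Z}}A$, that $\sum_{j=1}^s\mathbf{a}_j$ is even, and that $|\mathbf{a}_j|>1$ for some $1\le j\le s$. Then $\mathcal{P}_A$ does not have any regular triangulation (with vertices among its lattice points) that is unimodular with respect to the lattice $\operatorname{aff}(\mathcal{P}_A)\cap\mathbb{Z}^m$.
   Context: $\mathcal{P}_A=\operatorname{conv}$ of the columns of $A$ and $-A$. $A$ is saturated if every lattice point of $\mathcal{P}_A$ other than the origin occurs exactly once as a column of $[A\,|\,-A]$. A minimal linear dependency is a nonzero $\mathbf{a}\in\ker_{\mathbb{Z}}A$ such that no other $\mathbf{a}'\in\ker_{\mathbb{Z}}A$ has the same sign pattern with $|\mathbf{a}'_i|\le|\mathbf{a}_i|$ for all $i$. A triangulation of a lattice polytope is regular if it is induced by a height function on its vertices (maximal simplices are projections of lower faces of the lifted polytope). A $D$-dimensional simplex with vertices in the lattice $L=\operatorname{aff}(P)\cap\mathbb{Z}^m$ ($D=\dim P$) is unimodular with respect to $L$ if its Euclidean volume equals $|\det L|/D!$, where $\det L$ is the determinant of a lattice basis of $L$; a triangulation is unimodular w.r.t. $L$ if all its maximal simplices are. *)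

theory Defs
  imports "Jordan_Normal_Form.Determinant" "HOL-Analysis.Analysis"
begin

text \<open>Keep \<open>$\<close> and \<open>\<bullet>\<close> for the component selection and the inner product of HOL-Analysis.\<close>

no_notation Matrix.vec_index (infixl \<open>$\<close> 100)
no_notation Matrix.scalar_prod (infix \<open>\<bullet>\<close> 70)


section \<open>The polytope of an integer matrix\<close>

definition int_lattice :: "(real ^ 'm) set" where
  "int_lattice = {x. \<forall>i. x $ i \<in> \<int>}"

text \<open>The block matrix \<open>[A | -A]\<close>: its columns are indexed by the disjoint union \<open>'s + 's\<close>, so that
  repeated columns can be counted.\<close>

definition sym_matrix :: "int ^ 's ^ 'm \<Rightarrow> real ^ ('s + 's) ^ 'm" where
  "sym_matrix A = (\<chi> i k. case k of Inl j \<Rightarrow> of_int (A $ i $ j) | Inr j \<Rightarrow> - of_int (A $ i $ j))"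

definition sym_polytope :: "int ^ 's ^ 'm \<Rightarrow> (real ^ 'm) set" where
  "sym_polytope A = convex hull (columns (sym_matrix A))"

definition saturated :: "int ^ 's ^ 'm \<Rightarrow> bool" where
  "saturated A \<longleftrightarrow>
     (\<forall>x \<in> sym_polytope A \<inter> int_lattice. x \<noteq> 0 \<longrightarrow> (\<exists>!k. column k (sym_matrix A) = x))"

definition minimal_dependency :: "int ^ 's ^ 'm \<Rightarrow> int ^ 's \<Rightarrow> bool" where
  "minimal_dependency A a \<longleftrightarrow>
     a \<noteq> 0 \<and> A *v a = 0 \<and>
     \<not> (\<exists>a'. a' \<noteq> a \<and> A *v a' = 0 \<and> (\<forall>i. sgn (a' $ i) = sgn (a $ i) \<and> \<bar>a' $ i\<bar> \<le> \<bar>a $ i\<bar>))"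


section \<open>Triangulations\<close>

definition triangulation_of :: "'a::euclidean_space set set \<Rightarrow> 'a set \<Rightarrow> bool" where
  "triangulation_of T P \<longleftrightarrow> simplicial_complex T \<and> \<Union>T = P"

definition complex_vertices :: "'a::euclidean_space set set \<Rightarrow> 'a set" where
  "complex_vertices T = {v. {v} \<in> T}"

definition maximal_simplices :: "'a::euclidean_space set set \<Rightarrow> 'a set set" where
  "maximal_simplices T = {S \<in> T. \<forall>S' \<in> T. S \<subseteq> S' \<longrightarrow> S' = S}"

definition lifted_polytope :: "'a::euclidean_space set \<Rightarrow> ('a \<Rightarrow> real) \<Rightarrow> ('a \<times> real) set" where
  "lifted_polytope V h = convex hull ((\<lambda>v. (v, h v)) ` V)"

text \<open>A face is lower if it minimises a linear functional whose coefficient on the height coordinate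
  is positive; that coefficient is scaled to 1.\<close>

definition lower_face :: "('a::euclidean_space \<times> real) set \<Rightarrow> ('a \<times> real) set \<Rightarrow> bool" where
  "lower_face F Q \<longleftrightarrow>
     (\<exists>c. F = {q \<in> Q. \<forall>q' \<in> Q. c \<bullet> fst q + snd q \<le> c \<bullet> fst q' + snd q'})"

definition regular_triangulation_of :: "'a::euclidean_space set set \<Rightarrow> 'a set \<Rightarrow> bool" where
  "regular_triangulation_of T P \<longleftrightarrow>
     triangulation_of T P \<and>
     (\<exists>h. \<forall>S \<in> maximal_simplices T.
        \<exists>F. lower_face F (lifted_polytope (complex_vertices T) h) \<and> S = fst ` F)"


section \<open>Volume in a flat, and unimodularity\<close>

text \<open>For an orthonormal set \<open>B\<close>, \<open>flat_lborel p B\<close> is the Lebesgue measure of the affine subspace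
  \<open>p + span B\<close>, transported along the isometry that \<open>B\<close> provides; compare the definition of
  \<open>lborel\<close>, which is the case \<open>p = 0\<close> and \<open>B = Basis\<close>.\<close>

definition flat_lborel :: "'a::euclidean_space \<Rightarrow> 'a set \<Rightarrow> 'a measure" where
  "flat_lborel p B = distr (\<Pi>\<^sub>M b\<in>B. lborel) borel (\<lambda>f. p + (\<Sum>b\<in>B. f b *\<^sub>R b))"

definition orthonormal_basis_of :: "'a::euclidean_space set \<Rightarrow> 'a set \<Rightarrow> bool" where
  "orthonormal_basis_of B W \<longleftrightarrow>
     pairwise orthogonal B \<and> (\<forall>b \<in> B. norm b = 1) \<and> span B = span W"

text \<open>The Euclidean volume of \<open>S\<close> inside its own affine hull, i.e. the \<open>D\<close>-dimensional volume where
  \<open>D = aff_dim S\<close>; it does not depend on the point and the orthonormal basis chosen.\<close>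

definition flat_volume :: "'a::euclidean_space set \<Rightarrow> real" where
  "flat_volume S =
     measure (flat_lborel (SOME p. p \<in> S)
                (SOME B. orthonormal_basis_of B {x - y | x y. x \<in> S \<and> y \<in> S})) S"

definition lattice_basis :: "'a::euclidean_space list \<Rightarrow> 'a set \<Rightarrow> bool" where
  "lattice_basis bs L \<longleftrightarrow>
     distinct bs \<and> independent (set bs) \<and>
     L = {\<Sum>i<length bs. of_int (c i) *\<^sub>R bs ! i | c :: nat \<Rightarrow> int. True}"

text \<open>The absolute value of the determinant of a lattice basis, also when the lattice does not have
  full rank in the ambient space: the square root of the determinant of the Gram matrix. For \<open>n\<close>
  vectors in n-space this is the absolute value of the determinant of the matrix they form.\<close>

definition basis_det :: "'a::euclidean_space list \<Rightarrow> real" where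
  "basis_det bs =
     sqrt (Determinant.det (Matrix.mat (length bs) (length bs) (\<lambda>(i, j). bs ! i \<bullet> bs ! j)))"

text \<open>Here \<open>L = aff(P) \<inter> \<int>^m\<close>. It is used for polytopes \<open>P\<close> with \<open>0 \<in> aff(P)\<close>, where \<open>L\<close> is a
  subgroup. The determinant of \<open>L\<close> is the same for all lattice bases.\<close>

definition unimodular_simplex :: "(real ^ 'm) set \<Rightarrow> (real ^ 'm) set \<Rightarrow> bool" where
  "unimodular_simplex P S \<longleftrightarrow>
     aff_dim P simplex S \<and>
     {v. v extreme_point_of S} \<subseteq> affine hull P \<inter> int_lattice \<and>
     (\<exists>bs. lattice_basis bs (affine hull P \<inter> int_lattice) \<and>
           flat_volume S = basis_det bs / fact (nat (aff_dim P)))"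

definition unimodular_triangulation_of :: "(real ^ 'm) set set \<Rightarrow> (real ^ 'm) set \<Rightarrow> bool" where
  "unimodular_triangulation_of T P \<longleftrightarrow>
     triangulation_of T P \<and> (\<forall>S \<in> maximal_simplices T. unimodular_simplex P S)"

end

theory Submission
  imports Defs
begin

text \<open>
  Change the signs of the columns so that the dependency becomes \<open>b = \<bar>a\<bar> \<ge> 0\<close>, let \<open>v\<^sub>i\<close> be the new
  columns and \<open>2 k = \<Sum> b\<^sub>i\<close>. Comparing Gram determinants, the vertices of a unimodular simplex generate
  the lattice, so every lattice point of the \<open>n\<close>-th dilate of the polytope is a sum of \<open>n\<close> vertices of one
  simplex. Integer vectors representing the same point differ by an integer multiple of \<open>b\<close>, and a
  representation \<open>c + t b\<close> has norm at least \<open>\<bar>\<Sum> c\<^sub>i + 2 k t\<bar>\<close>. Hence any fewer than \<open>k\<close> of the \<open>v\<^sub>i\<close>, and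
  likewise of the \<open>- v\<^sub>i\<close>, are vertices of a common simplex.

  If there is an integer vector \<open>0 \<le> c \<le> b\<close> with sum \<open>k\<close> such that \<open>c\<close> and \<open>b - c\<close> both have an entry
  \<open>\<ge> 2\<close>, then both have fewer than \<open>k\<close> nonzero entries, and \<open>\<Sum> c\<^sub>i v\<^sub>i = \<Sum> (b\<^sub>i - c\<^sub>i) (- v\<^sub>i)\<close> gives a point in the relative
  interiors of two faces without a common vertex. Otherwise \<open>b\<close> has one entry 2 or 3 and all others
  are 0 or 1; then for a suitable \<open>c\<close> with sum \<open>k\<close> the lattice point \<open>\<Sum> c\<^sub>i v\<^sub>i\<close> lies in the \<open>(k - 1)\<close>-st
  dilate, because \<open>c - b / 2\<close> has norm \<open>k - 1\<close>, while all its integer representations have norm \<open>\<ge> k\<close>.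
\<close>

section \<open>The volume of a simplex in a flat\<close>

text \<open>Linear change of variables produces a determinant indexed by a finite type, while
  \<open>basis_det\<close> uses one indexed by numbers. Both are Leibniz sums; conjugating
  permutations with the enumeration \<open>f\<close> matches the terms and preserves signs.\<close>

lemma Determinants_det_eq_Determinant_det:
  fixes A :: "'a::comm_ring_1 ^ 'n ^ 'n"
  assumes f: "bij_betw f {0..<n} (UNIV :: 'n set)"
  shows "Determinants.det A = Determinant.det (Matrix.mat n n (\<lambda>(i, j). A $ f i $ f j))"
proof -
  let ?M = "map_permutation {0..<n} f"
  have inj: "inj_on f {0..<n}" using f by (simp add: bij_betw_def)
  have bij: "bij_betw ?M {p. p permutes {0..<n}} {p. p permutes UNIV}"
  proof (rule bij_betwI[where g = "map_permutation UNIV (inv_into {0..<n} f)"])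
    show "?M \<in> {p. p permutes {0..<n}} \<rightarrow> {p. p permutes UNIV}"
      using map_permutation_permutes[OF f] by blast
    show "map_permutation UNIV (inv_into {0..<n} f) \<in> {p. p permutes UNIV} \<rightarrow> {p. p permutes {0..<n}}"
      using map_permutation_permutes[OF bij_betw_inv_into[OF f]] by blast
    show "map_permutation UNIV (inv_into {0..<n} f) (?M p) = p" if "p \<in> {p. p permutes {0..<n}}" for p
      using that by (intro map_permutation_compose_inv[OF f]) (auto simp: inj)
    show "?M (map_permutation UNIV (inv_into {0..<n} f) p) = p" if "p \<in> {p. p permutes UNIV}" for p
      using that by (intro map_permutation_compose_inv[OF bij_betw_inv_into[OF f]])
        (auto intro!: f_inv_into_f simp: bij_betw_imp_surj_on[OF f])
  qed
  have "Determinants.det A = (\<Sum>p | p permutes (UNIV::'n set). of_int (sign p) * (\<Prod>i\<in>UNIV. A $ i $ p i))"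
    by (simp add: Determinants.det_def)
  also have "\<dots> = (\<Sum>p | p permutes {0..<n}. of_int (sign (?M p)) * (\<Prod>i\<in>UNIV. A $ i $ ?M p i))"
    by (rule sum.reindex_bij_betw[OF bij, symmetric])
  also have "\<dots> = (\<Sum>p | p permutes {0..<n}. signof p * (\<Prod>i = 0..<n. A $ f i $ f (p i)))"
  proof (rule sum.cong[OF refl])
    fix p assume p: "p \<in> {p. p permutes {0..<n}}"
    have "(\<Prod>i\<in>UNIV. A $ i $ ?M p i) = (\<Prod>i = 0..<n. A $ f i $ ?M p (f i))"
      by (rule prod.reindex_bij_betw[OF f, symmetric])
    also have "\<dots> = (\<Prod>i = 0..<n. A $ f i $ f (p i))"
      by (rule prod.cong) (auto simp: map_permutation_apply[OF inj])
    finally show "of_int (sign (?M p)) * (\<Prod>i\<in>UNIV. A $ i $ ?M p i) = signof p * (\<Prod>i = 0..<n. A $ f i $ f (p i))"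
      using p by (simp add: sign_map_permutation[OF inj _ finite_atLeastLessThan])
  qed
  also have "\<dots> = Determinant.det (Matrix.mat n n (\<lambda>(i, j). A $ f i $ f j))"
    by (subst det_def'[of _ n]) (auto intro!: sum.cong prod.cong simp: permutes_in_image)
  finally show ?thesis .
qed

text \<open>Boxes pull back to boxes with the same factors in another order, and boxes determine a
  product measure. This moves integrals between coordinates indexed by an orthonormal basis and
  coordinates indexed by numbers.\<close>

lemma PiM_lborel_reindex:
  fixes f :: "'a \<Rightarrow> 'b"
  assumes f: "bij_betw f I J" and I: "finite I"
  shows "Pi\<^sub>M I (\<lambda>_. lborel :: real measure) = distr (Pi\<^sub>M J (\<lambda>_. lborel)) (Pi\<^sub>M I (\<lambda>_. lborel)) (\<lambda>x. \<lambda>i\<in>I. x (f i))"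
proof -
  interpret product_sigma_finite "\<lambda>_. lborel :: real measure" by standard
  have fin: "finite J" using f I bij_betw_finite by blast
  have m: "(\<lambda>x. \<lambda>i\<in>I. x (f i)) \<in> measurable (Pi\<^sub>M J (\<lambda>_. lborel)) (Pi\<^sub>M I (\<lambda>_. lborel :: real measure))"
    using f by (intro measurable_restrict measurable_component_singleton) (auto simp: bij_betw_def)
  show ?thesis
  proof (rule PiM_eqI[symmetric])
    fix A :: "'a \<Rightarrow> real set" assume A: "\<And>i. i \<in> I \<Longrightarrow> A i \<in> sets lborel"
    have s: "Pi\<^sub>E I A \<in> sets (Pi\<^sub>M I (\<lambda>_. lborel))" using A I by (intro sets_PiM_I_finite) auto
    let ?g = "inv_into I f"
    have "(\<lambda>x. \<lambda>i\<in>I. x (f i)) -` (Pi\<^sub>E I A) \<inter> space (Pi\<^sub>M J (\<lambda>_. lborel :: real measure)) = Pi\<^sub>E J (\<lambda>j. A (?g j))"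
      using f bij_betw_inv_into_left[OF f] bij_betw_inv_into_right[OF f] bij_betw_apply[OF f] bij_betw_apply[OF bij_betw_inv_into[OF f]]
      by (auto simp: space_PiM PiE_iff extensional_def) (metis, fastforce)
    then have "emeasure (distr (Pi\<^sub>M J (\<lambda>_. lborel)) (Pi\<^sub>M I (\<lambda>_. lborel)) (\<lambda>x. \<lambda>i\<in>I. x (f i))) (Pi\<^sub>E I A)
        = emeasure (Pi\<^sub>M J (\<lambda>_. lborel :: real measure)) (Pi\<^sub>E J (\<lambda>j. A (?g j)))"
      by (simp only: emeasure_distr[OF m s])
    also have "\<dots> = (\<Prod>j\<in>J. emeasure lborel (A (?g j)))"
      using A bij_betw_apply[OF bij_betw_inv_into[OF f]] fin by (intro emeasure_PiM) auto
    also have "\<dots> = (\<Prod>i\<in>I. emeasure lborel (A i))"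
      by (rule prod.reindex_bij_betw[OF bij_betw_inv_into[OF f]])
    finally show "emeasure (distr (Pi\<^sub>M J (\<lambda>_. lborel)) (Pi\<^sub>M I (\<lambda>_. lborel)) (\<lambda>x. \<lambda>i\<in>I. x (f i))) (Pi\<^sub>E I A)
       = (\<Prod>i\<in>I. emeasure lborel (A i))" .
  qed (use I in auto)
qed

lemma lborel_cart_eq_distr_PiM:
  fixes f :: "nat \<Rightarrow> 'n::finite"
  assumes f: "bij_betw f {..<n} (UNIV :: 'n::finite set)"
  shows "(lborel :: (real ^ 'n) measure) =
    distr (Pi\<^sub>M {..<n} (\<lambda>_. lborel)) borel (\<lambda>g. \<chi> i. g (inv_into {..<n} f i))"
proof -
  have b1: "bij_betw (\<lambda>i. axis i (1::real)) (UNIV :: 'n set) Basis"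
    by (auto simp: bij_betw_def inj_on_def axis_eq_axis Basis_vec_def)
  define h where "h = (\<lambda>b :: real ^ 'n. inv_into {..<n} f (inv_into UNIV (\<lambda>i. axis i 1) b))"
  have h: "bij_betw h (Basis :: (real^'n) set) {..<n}"
    unfolding h_def by (rule bij_betw_trans[OF bij_betw_inv_into[OF b1] bij_betw_inv_into[OF f], unfolded o_def])
  have hax: "h (axis i 1) = inv_into {..<n} f i" for i
    unfolding h_def by (subst inv_into_f_f) (use b1 in \<open>auto simp: bij_betw_def\<close>)
  have m: "(\<lambda>x. \<lambda>b\<in>Basis. x (h b)) \<in> measurable (Pi\<^sub>M {..<n} (\<lambda>_. lborel)) (Pi\<^sub>M (Basis :: (real^'n) set) (\<lambda>_. lborel :: real measure))"
    using h by (intro measurable_restrict measurable_component_singleton) (auto simp: bij_betw_def)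
  have "(lborel :: (real ^ 'n) measure) = distr (Pi\<^sub>M Basis (\<lambda>_. lborel)) borel (\<lambda>g. \<Sum>b\<in>Basis. g b *\<^sub>R b)"
    by (rule lborel_eq)
  also have "\<dots> = distr (Pi\<^sub>M {..<n} (\<lambda>_. lborel)) borel ((\<lambda>g. \<Sum>b\<in>Basis. g b *\<^sub>R b) \<circ> (\<lambda>x. \<lambda>b\<in>Basis. x (h b)))"
    by (subst PiM_lborel_reindex[OF h finite_Basis], subst distr_distr) (use m in auto)
  also have "(\<lambda>g. \<Sum>b\<in>Basis. g b *\<^sub>R b) \<circ> (\<lambda>x. \<lambda>b\<in>Basis. x (h b)) = (\<lambda>g. \<chi> i. g (inv_into {..<n} f i) :: real ^ 'n)"
  proof
    fix g :: "nat \<Rightarrow> real"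
    have "(\<Sum>b\<in>Basis. g (h b) *\<^sub>R b) = (\<Sum>i\<in>UNIV. g (h (axis i 1)) *\<^sub>R (axis i 1 :: real ^ 'n))"
      by (rule sum.reindex_bij_betw[OF b1, symmetric])
    also have "\<dots> = (\<chi> i. g (inv_into {..<n} f i))"
      unfolding hax by (simp add: vec_eq_iff axis_def if_distrib cong: if_cong)
    finally show "((\<lambda>g. \<Sum>b\<in>Basis. g b *\<^sub>R b) \<circ> (\<lambda>x. \<lambda>b\<in>Basis. x (h b))) g = (\<chi> i. g (inv_into {..<n} f i))"
      by simp
  qed
  finally show ?thesis .
qed

text \<open>Multiplying by a unit cube reduces a volume in dimension \<open>D\<close>, which is not the dimension of any
  type, to a volume in \<open>real ^ 'n\<close>, where the change of variables formula is available.\<close>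

lemma emeasure_prism:
  fixes f :: "nat \<Rightarrow> 'n::finite"
  assumes f: "bij_betw f {..<n} (UNIV :: 'n set)" and D: "D \<le> n"
    and Q: "Q \<in> sets (Pi\<^sub>M {..<D} (\<lambda>_. lborel :: real measure))"
    and Z: "Z = {x :: real ^ 'n. (\<lambda>i\<in>{..<D}. x $ f i) \<in> Q \<and> (\<forall>i\<in>{D..<n}. 0 \<le> x $ f i \<and> x $ f i \<le> 1)}"
  shows "Z \<in> sets borel" and "emeasure lborel Z = emeasure (Pi\<^sub>M {..<D} (\<lambda>_. lborel)) Q"
proof -
  interpret product_sigma_finite "\<lambda>_. lborel :: real measure" by standard
  have m0: "(\<lambda>x. \<lambda>i\<in>{..<D}. x $ f i) \<in> measurable borel (Pi\<^sub>M {..<D} (\<lambda>_. lborel :: real measure))"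
    by (intro measurable_restrict) auto
  have "Z = ((\<lambda>x. \<lambda>i\<in>{..<D}. x $ f i) -` Q \<inter> space borel) \<inter> (\<Inter>i\<in>{D..<n}. {x. 0 \<le> x $ f i \<and> x $ f i \<le> 1})
     \<inter> UNIV"
    by (auto simp: Z)
  also have "\<dots> \<in> sets borel"
    using measurable_sets[OF m0 Q] by (cases "{D..<n} = {}")
       (auto intro!: sets.Int sets.finite_INT borel_closed closed_Collect_conj closed_Collect_le continuous_intros)
  finally show Zb: "Z \<in> sets borel" .
  let ?e = "\<lambda>g. (\<chi> i. g (inv_into {..<n} f i)) :: real ^ 'n"
  have fi: "inv_into {..<n} f (f i) = i" if "i < n" for i
    using that f by (auto simp: bij_betw_def)
  have ii: "inv_into {..<n} f i < n" for i
    using bij_betw_apply[OF bij_betw_inv_into[OF f]] by auto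
  have me: "?e \<in> measurable (Pi\<^sub>M {..<n} (\<lambda>_. lborel)) borel"
  proof -
    have "(\<lambda>x. x i) \<in> measurable (Pi\<^sub>M {..<n} (\<lambda>_. lborel :: real measure)) lborel" if "i < n" for i
      using that by (intro measurable_component_singleton) auto
    then show ?thesis
      using ii by (subst borel_measurable_euclidean_space) (auto simp: Basis_vec_def inner_axis)
  qed
  have mm: "merge {..<D} {D..<n} \<in> measurable (Pi\<^sub>M {..<D} (\<lambda>_. lborel) \<Otimes>\<^sub>M Pi\<^sub>M {D..<n} (\<lambda>_. lborel)) (Pi\<^sub>M ({..<D} \<union> {D..<n}) (\<lambda>_. lborel :: real measure))"
    by (rule measurable_merge)
  have un: "{..<D} \<union> {D..<n} = {..<n}" using D by auto
  interpret J: sigma_finite_measure "Pi\<^sub>M {D..<n} (\<lambda>_. lborel :: real measure)"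
    by (rule sigma_finite) simp
  have cube: "(\<Pi>\<^sub>E i\<in>{D..<n}. {0..1::real}) \<in> sets (Pi\<^sub>M {D..<n} (\<lambda>_. lborel))"
    by (intro sets_PiM_I_finite) auto
  have E: "?e -` Z \<inter> space (Pi\<^sub>M {..<n} (\<lambda>_. lborel :: real measure)) \<in> sets (Pi\<^sub>M {..<n} (\<lambda>_. lborel))"
    by (rule measurable_sets[OF me Zb])
  have "emeasure lborel Z = emeasure (Pi\<^sub>M {..<n} (\<lambda>_. lborel)) (?e -` Z \<inter> space (Pi\<^sub>M {..<n} (\<lambda>_. lborel)))"
    by (subst lborel_cart_eq_distr_PiM[OF f], rule emeasure_distr[OF me Zb])
  also have "\<dots> = emeasure (distr (Pi\<^sub>M {..<D} (\<lambda>_. lborel) \<Otimes>\<^sub>M Pi\<^sub>M {D..<n} (\<lambda>_. lborel)) (Pi\<^sub>M ({..<D} \<union> {D..<n}) (\<lambda>_. lborel)) (merge {..<D} {D..<n}))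
      (?e -` Z \<inter> space (Pi\<^sub>M {..<n} (\<lambda>_. lborel)))"
    by (subst distr_merge) (auto simp: un)
  also have "\<dots> = emeasure (Pi\<^sub>M {..<D} (\<lambda>_. lborel) \<Otimes>\<^sub>M Pi\<^sub>M {D..<n} (\<lambda>_. lborel))
      (merge {..<D} {D..<n} -` (?e -` Z \<inter> space (Pi\<^sub>M {..<n} (\<lambda>_. lborel)))
        \<inter> space (Pi\<^sub>M {..<D} (\<lambda>_. lborel) \<Otimes>\<^sub>M Pi\<^sub>M {D..<n} (\<lambda>_. lborel :: real measure)))"
    using E by (intro emeasure_distr mm) (simp add: un)
  also have "merge {..<D} {D..<n} -` (?e -` Z \<inter> space (Pi\<^sub>M {..<n} (\<lambda>_. lborel :: real measure)))
        \<inter> space (Pi\<^sub>M {..<D} (\<lambda>_. lborel) \<Otimes>\<^sub>M Pi\<^sub>M {D..<n} (\<lambda>_. lborel :: real measure))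
      = Q \<times> (\<Pi>\<^sub>E i\<in>{D..<n}. {0..1})" (is "?L = ?R")
  proof (rule Set.set_eqI)
    fix z :: "(nat \<Rightarrow> real) \<times> (nat \<Rightarrow> real)"
    obtain x y where z: "z = (x, y)" by (cases z)
    \<comment> \<open>Members of \<open>Q\<close> are extensional, so for an extensional
      \<open>x\<close> membership of \<open>restrict x {..<D}\<close> is membership of
      \<open>x\<close> itself; this makes the preimage an exact product of \<open>Q\<close> with the
      cube.\<close>
    have Qs: "Q \<subseteq> extensional {..<D}" using sets.sets_into_space[OF Q] by (fastforce simp: space_PiM PiE_iff)
    have ms: "merge {..<D} {D..<n} (x, y) \<in> extensional {..<n}"
      using D by (auto simp: merge_def extensional_def)
    have "?e (merge {..<D} {D..<n} (x, y)) $ f i = (if i < D then x i else y i)" if "i < n" for i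
      using that by (simp add: fi merge_def)
    then have "?e (merge {..<D} {D..<n} (x, y)) \<in> Z \<longleftrightarrow> restrict x {..<D} \<in> Q \<and> (\<forall>i\<in>{D..<n}. 0 \<le> y i \<and> y i \<le> 1)"
      using D by (auto simp: Z cong: restrict_cong)
    then have "z \<in> ?L \<longleftrightarrow> restrict x {..<D} \<in> Q \<and> (\<forall>i\<in>{D..<n}. 0 \<le> y i \<and> y i \<le> 1) \<and> x \<in> extensional {..<D} \<and> y \<in> extensional {D..<n}"
      using ms by (auto simp: z space_pair_measure space_PiM PiE_def)
    also have "\<dots> \<longleftrightarrow> z \<in> ?R"
      using Qs by (auto simp: z PiE_iff extensional_restrict)
    finally show "z \<in> ?L \<longleftrightarrow> z \<in> ?R" .
  qed
  also have "emeasure (Pi\<^sub>M {..<D} (\<lambda>_. lborel) \<Otimes>\<^sub>M Pi\<^sub>M {D..<n} (\<lambda>_. lborel)) (Q \<times> (\<Pi>\<^sub>E i\<in>{D..<n}. {0..1::real}))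
      = emeasure (Pi\<^sub>M {..<D} (\<lambda>_. lborel)) Q * emeasure (Pi\<^sub>M {D..<n} (\<lambda>_. lborel)) (\<Pi>\<^sub>E i\<in>{D..<n}. {0..1::real})"
    by (rule J.emeasure_pair_measure_Times[OF Q cube])
  also have "emeasure (Pi\<^sub>M {D..<n} (\<lambda>_. lborel)) (\<Pi>\<^sub>E i\<in>{D..<n}. {0..1::real}) = 1"
    by (subst emeasure_PiM) auto
  finally show "emeasure lborel Z = emeasure (Pi\<^sub>M {..<D} (\<lambda>_. lborel)) Q" by simp
qed


section \<open>Volumes of simplices as determinants\<close>

text \<open>\<open>Q\<close> is the image of the standard simplex, of volume
  \<open>1 / fact D\<close>, under an affine map whose linear part is given by \<open>W\<close>.
  Taking prisms over both sets and extending the linear part by the identity turns this into a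
  linear change of variables on the full space, with a block diagonal matrix of the same determinant
  up to transposition.\<close>

lemma measure_PiM_simplex:
  fixes f :: "nat \<Rightarrow> 'n::{finite,wellorder}" and W :: "nat \<Rightarrow> nat \<Rightarrow> real"
  assumes f: "bij_betw f {..<n} (UNIV :: 'n set)" and D: "D \<le> n"
    and Q: "Q \<in> sets (Pi\<^sub>M {..<D} (\<lambda>_. lborel :: real measure))"
    and Qeq: "Q = {g \<in> extensional {..<D}. \<exists>t. (\<forall>i<D. 0 \<le> t i) \<and> (\<Sum>i<D. t i) \<le> 1 \<and>
                (\<forall>l<D. g l = q l + (\<Sum>i<D. t i * W i l))}"
  shows "measure (Pi\<^sub>M {..<D} (\<lambda>_. lborel)) Q = \<bar>Determinant.det (Matrix.mat D D (\<lambda>(i, l). W i l))\<bar> / fact D"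
proof -
  define g where "g = inv_into {..<n} f"
  have gf: "g (f i) = i" if "i < n" for i
    using that f by (auto simp: bij_betw_def g_def)
  have fg: "f (g y) = y" and gn: "g y < n" for y
    using bij_betw_apply[OF bij_betw_inv_into[OF f]] bij_betw_inv_into_right[OF f, of y] by (auto simp: g_def)
  \<comment> \<open>The first \<open>D\<close> coordinates are transformed by \<open>W\<close> and
    the others are kept, so the prism over the standard simplex goes to a translate of the prism
    over \<open>Q\<close>.\<close>
  define h where "h = (\<lambda>x :: (real, 'n) vec. (\<chi> y. if g y < D then \<Sum>k<D. x $ f k * W k (g y) else x $ y) :: (real, 'n) vec)"
  have lin: "linear h"
    by (auto simp: linear_iff vec_eq_iff h_def sum.distrib sum_distrib_left algebra_simps)
  define Del where "Del = {x. (\<forall>i\<in>{..<D}. 0 \<le> x i) \<and> sum x {..<D} \<le> 1} \<inter> space (Pi\<^sub>M {..<D} (\<lambda>_. lborel :: real measure))"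
  have eDel: "emeasure (Pi\<^sub>M {..<D} (\<lambda>_. lborel)) Del = ennreal (1 / fact D)"
    unfolding Del_def by (subst emeasure_std_simplex_aux) auto
  \<comment> \<open>A set that is not measurable has \<open>emeasure\<close> 0, but
    \<open>Del\<close> has the positive value \<open>1 / fact D\<close>.\<close>
  have Del: "Del \<in> sets (Pi\<^sub>M {..<D} (\<lambda>_. lborel :: real measure))"
    by (rule ccontr) (use eDel emeasure_notin_sets in fastforce)
  define Z where "Z = (\<lambda>Q. {x :: (real, 'n) vec. (\<lambda>i\<in>{..<D}. x $ f i) \<in> Q \<and> (\<forall>i\<in>{D..<n}. 0 \<le> x $ f i \<and> x $ f i \<le> 1)})"
  note ZD = emeasure_prism[OF f D Del Z_def[THEN fun_cong]]
  note ZQ = emeasure_prism[OF f D Q Z_def[THEN fun_cong]]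
  define q' where "q' = (\<chi> y. if g y < D then q (g y) else 0 :: (real, 'n) vec)"
  have eq: "Z Q = (+) q' ` (h ` Z Del)"
  proof (intro Set.set_eqI iffI)
    fix x assume x: "x \<in> Z Q"
    then obtain t where t: "\<forall>i<D. 0 \<le> t i" "(\<Sum>i<D. t i) \<le> 1" "\<forall>l<D. x $ f l = q l + (\<Sum>i<D. t i * W i l)"
      by (auto simp: Z_def Qeq)
    define u where "u = (\<chi> y. if g y < D then t (g y) else x $ y :: (real, 'n) vec)"
    have uf: "u $ f i = t i" if "i < D" for i using that D by (simp add: u_def gf)
    have uf': "u $ f i = x $ f i" if "D \<le> i" "i < n" for i using that by (simp add: u_def gf)
    have "(\<lambda>i\<in>{..<D}. u $ f i) \<in> Del" using t by (auto simp: Del_def space_PiM uf)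
    then have "u \<in> Z Del" using x by (auto simp: Z_def uf')
    moreover have "x = q' + h u"
    proof (rule vec_eq_iff[THEN iffD2, rule_format])
      fix y
      have "x $ y = q (g y) + (\<Sum>i<D. t i * W i (g y))" if "g y < D"
        using t(3)[rule_format, OF that] by (simp add: fg)
      then show "x $ y = (q' + h u) $ y"
        by (auto simp: q'_def h_def uf) (simp add: u_def)
    qed
    ultimately show "x \<in> (+) q' ` (h ` Z Del)" by blast
  next
    fix x assume "x \<in> (+) q' ` (h ` Z Del)"
    then obtain u where u: "u \<in> Z Del" "x = q' + h u" by blast
    have xf: "x $ f l = q l + (\<Sum>i<D. u $ f i * W i l)" if "l < D" for l
      using that D by (simp add: u(2) q'_def h_def gf)
    have xf': "x $ f l = u $ f l" if "D \<le> l" "l < n" for l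
      using that by (simp add: u(2) q'_def h_def gf)
    have "\<forall>i<D. 0 \<le> u $ f i" "(\<Sum>i<D. u $ f i) \<le> 1"
      using u(1) by (auto simp: Z_def Del_def)
    then have "(\<lambda>i\<in>{..<D}. x $ f i) \<in> Q"
      unfolding Qeq by (auto simp: xf intro!: exI[of _ "\<lambda>i. u $ f i"])
    then show "x \<in> Z Q" using u(1) by (auto simp: Z_def xf')
  qed
  have ZDl: "Z Del \<in> lmeasurable"
    using ZD by (intro fmeasurableI) (auto simp: eDel)
  have "measure (Pi\<^sub>M {..<D} (\<lambda>_. lborel)) Q = measure lborel (Z Q)"
    by (simp add: measure_def ZQ(2))
  also have "\<dots> = measure lebesgue (Z Q)" using ZQ(1) by simp
  also have "\<dots> = measure lebesgue (h ` Z Del)" unfolding eq by (rule measure_translation)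
  also have "\<dots> = \<bar>Determinants.det (matrix h)\<bar> * measure lebesgue (Z Del)"
    by (rule measure_linear_image[OF lin ZDl])
  also have "measure lebesgue (Z Del) = 1 / fact D"
    using ZD by (simp add: measure_def eDel)
  also have "Determinants.det (matrix h) = Determinant.det (Matrix.mat D D (\<lambda>(i, l). W i l))"
  proof -
    let ?W = "Matrix.mat D D (\<lambda>(i, l). W i l)"
    have m: "matrix h $ f i $ f j = (if i < D then if j < D then W j i else 0 else if i = j then 1 else 0)"
      if "i < n" "j < n" for i j
    proof -
      have inj: "f a = f b \<longleftrightarrow> a = b" if "a < n" "b < n" for a b using gf that by metis
      have "(\<Sum>k<D. axis (f j) 1 $ f k * W k i) = (\<Sum>k<D. if k = j then W k i else 0)"
        using that D by (intro sum.cong) (auto simp: axis_def inj)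
      then show ?thesis using that by (auto simp: matrix_def h_def gf axis_def inj)
    qed
    have "Determinants.det (matrix h) = Determinant.det (Matrix.mat n n (\<lambda>(i, j). matrix h $ f i $ f j))"
      by (rule Determinants_det_eq_Determinant_det) (use f in \<open>simp add: atLeast0LessThan\<close>)
    \<comment> \<open>The transpose appears because \<open>W i l\<close> is the \<open>l\<close>-th
      coordinate of the \<open>i\<close>-th edge, so edges are the rows of \<open>W\<close> but the
      columns of the matrix of \<open>h\<close>.\<close>
    also have "Matrix.mat n n (\<lambda>(i, j). matrix h $ f i $ f j) =
        four_block_mat (transpose_mat ?W) (0\<^sub>m D (n - D)) (0\<^sub>m (n - D) D) (1\<^sub>m (n - D))"
      using D by (intro eq_matI) (auto simp: m)
    also have "Determinant.det \<dots> = Determinant.det (transpose_mat ?W) * Determinant.det (1\<^sub>m (n - D))"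
      by (rule det_four_block_mat_lower_left_zero) auto
    also have "\<dots> = Determinant.det ?W" by (subst Determinant.det_transpose[of _ D]) auto
    finally show ?thesis .
  qed
  finally show ?thesis by simp
qed

text \<open>Expanding each \<open>es i\<close> in the orthonormal basis writes the Gram matrix as
  the coordinate matrix times its transpose.\<close>

lemma det_gram_orthonormal:
  fixes es :: "nat \<Rightarrow> 'a::euclidean_space"
  assumes B: "pairwise orthogonal B" "\<forall>b\<in>B. norm b = 1" "finite B"
    and \<beta>: "bij_betw \<beta> {..<D} B" and es: "\<And>i. i < D \<Longrightarrow> es i \<in> span B"
  shows "Determinant.det (Matrix.mat D D (\<lambda>(i, j). es i \<bullet> es j)) =
     (Determinant.det (Matrix.mat D D (\<lambda>(i, l). es i \<bullet> \<beta> l)))\<^sup>2"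
proof -
  let ?W = "Matrix.mat D D (\<lambda>(i, l). es i \<bullet> \<beta> l)"
  have "es i \<bullet> es j = (\<Sum>l = 0..<D. (es i \<bullet> \<beta> l) * (es j \<bullet> \<beta> l))" if "i < D" "j < D" for i j
  proof -
    have "es i \<bullet> es j = (\<Sum>b\<in>B. (es i \<bullet> b) *\<^sub>R b) \<bullet> es j"
      by (subst orthonormal_basis_expand[of B]) (use B es[OF that(1)] in auto)
    also have "\<dots> = (\<Sum>b\<in>B. (es i \<bullet> b) * (b \<bullet> es j))"
      by (simp add: inner_sum_left)
    also have "\<dots> = (\<Sum>b\<in>B. (es i \<bullet> b) * (es j \<bullet> b))"
      by (simp add: inner_commute)
    also have "\<dots> = (\<Sum>l<D. (es i \<bullet> \<beta> l) * (es j \<bullet> \<beta> l))"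
      by (rule sum.reindex_bij_betw[OF \<beta>, symmetric])
    finally show ?thesis by (simp add: atLeast0LessThan)
  qed
  then have "Matrix.mat D D (\<lambda>(i, j). es i \<bullet> es j) = ?W * transpose_mat ?W"
    by (intro eq_matI) (auto simp: Matrix.scalar_prod_def)
  then show ?thesis
    by (simp add: Determinant.det_mult[of _ D] Determinant.det_transpose[of _ D] power2_eq_square)
qed

text \<open>Pulled back along the parametrisation of the flat, \<open>S\<close> becomes a simplex in
  coordinate space with edge matrix \<open>es i \<bullet> \<beta> l\<close>. The base point
  \<open>p\<close> need not be the vertex \<open>p0\<close>: their difference lies in the span of
  \<open>B\<close> and becomes a translation \<open>q\<close> in
  \<open>measure_PiM_simplex\<close>.\<close>

lemma measure_flat_lborel_simplex:
  fixes f :: "nat \<Rightarrow> 'n::{finite,wellorder}" and es :: "nat \<Rightarrow> 'a::euclidean_space"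
  assumes f: "bij_betw f {..<n} (UNIV :: 'n set)" and D: "D \<le> n"
    and B: "pairwise orthogonal B" "\<forall>b\<in>B. norm b = 1" "finite B"
    and \<beta>: "bij_betw \<beta> {..<D} B" and es: "\<And>i. i < D \<Longrightarrow> es i \<in> span B"
    and p: "p0 - p \<in> span B"
    and S: "S = {p0 + (\<Sum>i<D. t i *\<^sub>R es i) | t. (\<forall>i<D. 0 \<le> t i) \<and> (\<Sum>i<D. t i) \<le> 1}"
    and borel: "S \<in> sets borel"
  shows "measure (flat_lborel p B) S = \<bar>Determinant.det (Matrix.mat D D (\<lambda>(i, l). es i \<bullet> \<beta> l))\<bar> / fact D"
proof -
  let ?P = "Pi\<^sub>M {..<D} (\<lambda>_. lborel :: real measure)"
  define e where "e = (\<lambda>x. p + (\<Sum>l<D. x l *\<^sub>R \<beta> l))"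
  let ?i = "inv_into {..<D} \<beta>"
  have i: "bij_betw ?i B {..<D}" by (rule bij_betw_inv_into[OF \<beta>])
  have c: "(\<lambda>x. x i) \<in> borel_measurable ?P" if "i < D" for i
  proof -
    have "(\<lambda>x. x i) \<in> measurable ?P lborel"
      using that by (intro measurable_component_singleton) auto
    then show ?thesis by simp
  qed
  have me: "e \<in> borel_measurable ?P"
    unfolding e_def using c by (intro borel_measurable_add borel_measurable_sum borel_measurable_scaleR) auto
  have mB: "(\<lambda>x. \<lambda>b\<in>B. x (?i b)) \<in> measurable ?P (Pi\<^sub>M B (\<lambda>_. lborel :: real measure))"
    using i by (intro measurable_restrict measurable_component_singleton) (auto simp: bij_betw_def)
  have mf: "(\<lambda>g. p + (\<Sum>b\<in>B. g b *\<^sub>R b)) \<in> measurable (Pi\<^sub>M B (\<lambda>_. lborel :: real measure)) borel"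
  proof -
    have "(\<lambda>x. x b) \<in> measurable (Pi\<^sub>M B (\<lambda>_. lborel :: real measure)) lborel" if "b \<in> B" for b
      using that by (intro measurable_component_singleton) auto
    then show ?thesis
      by (intro borel_measurable_add borel_measurable_sum borel_measurable_scaleR) auto
  qed
  have "flat_lborel p B = distr ?P borel ((\<lambda>g. p + (\<Sum>b\<in>B. g b *\<^sub>R b)) \<circ> (\<lambda>x. \<lambda>b\<in>B. x (?i b)))"
    unfolding flat_lborel_def
    by (subst PiM_lborel_reindex[OF i B(3)], rule distr_distr[OF mf mB])
  also have "(\<lambda>g. p + (\<Sum>b\<in>B. g b *\<^sub>R b)) \<circ> (\<lambda>x. \<lambda>b\<in>B. x (?i b)) = e"
  proof
    fix x :: "nat \<Rightarrow> real"
    have "(\<Sum>b\<in>B. x (?i b) *\<^sub>R b) = (\<Sum>l<D. x (?i (\<beta> l)) *\<^sub>R \<beta> l)"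
      by (rule sum.reindex_bij_betw[OF \<beta>, symmetric])
    also have "\<dots> = (\<Sum>l<D. x l *\<^sub>R \<beta> l)"
      using bij_betw_inv_into_left[OF \<beta>] by (intro sum.cong) auto
    finally show "((\<lambda>g. p + (\<Sum>b\<in>B. g b *\<^sub>R b)) \<circ> (\<lambda>x. \<lambda>b\<in>B. x (?i b))) x = e x"
      by (simp add: e_def)
  qed
  finally have "measure (flat_lborel p B) S = measure ?P (e -` S \<inter> space ?P)"
    using measure_distr[OF me borel] by simp
  also have "\<dots> = \<bar>Determinant.det (Matrix.mat D D (\<lambda>(i, l). es i \<bullet> \<beta> l))\<bar> / fact D"
  proof (rule measure_PiM_simplex[OF f D])
    show "e -` S \<inter> space ?P \<in> sets ?P" by (rule measurable_sets[OF me borel])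
    have orth: "\<beta> l \<bullet> \<beta> k = (if l = k then 1 else 0)" if "l < D" "k < D" for l k
    proof (cases "l = k")
      case True
      then show ?thesis using B(2) bij_betw_apply[OF \<beta>, of l] that by (auto simp: dot_square_norm)
    next
      case False
      then have "\<beta> l \<noteq> \<beta> k" using \<beta> that by (auto simp: bij_betw_def inj_on_def)
      then show ?thesis
        using False B(1) bij_betw_apply[OF \<beta>, of l] bij_betw_apply[OF \<beta>, of k] that
        by (auto simp: pairwise_def orthogonal_def)
    qed
    have coord: "(\<Sum>l<D. g l *\<^sub>R \<beta> l) = y \<longleftrightarrow> (\<forall>l<D. g l = y \<bullet> \<beta> l)" if y: "y \<in> span B" for g y
    proof
      assume "(\<Sum>l<D. g l *\<^sub>R \<beta> l) = y"
      then have "y \<bullet> \<beta> l = (\<Sum>k<D. g k * (\<beta> k \<bullet> \<beta> l))" for l by (auto simp: inner_sum_left)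
      then show "\<forall>l<D. g l = y \<bullet> \<beta> l" by (simp add: orth if_distrib cong: if_cong)
    next
      assume "\<forall>l<D. g l = y \<bullet> \<beta> l"
      then have "(\<Sum>l<D. g l *\<^sub>R \<beta> l) = (\<Sum>l<D. (y \<bullet> \<beta> l) *\<^sub>R \<beta> l)" by simp
      also have "\<dots> = (\<Sum>b\<in>B. (y \<bullet> b) *\<^sub>R b)" by (rule sum.reindex_bij_betw[OF \<beta>])
      also have "\<dots> = y" by (rule orthonormal_basis_expand) (use B y in auto)
      finally show "(\<Sum>l<D. g l *\<^sub>R \<beta> l) = y" .
    qed
    have "e g = p0 + (\<Sum>i<D. t i *\<^sub>R es i) \<longleftrightarrow> (\<forall>l<D. g l = (p0 - p) \<bullet> \<beta> l + (\<Sum>i<D. t i * (es i \<bullet> \<beta> l)))"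
      for g t
    proof -
      have "e g = p0 + (\<Sum>i<D. t i *\<^sub>R es i) \<longleftrightarrow> (\<Sum>l<D. g l *\<^sub>R \<beta> l) = (p0 - p) + (\<Sum>i<D. t i *\<^sub>R es i)"
        by (auto simp: e_def algebra_simps)
      also have "\<dots> \<longleftrightarrow> (\<forall>l<D. g l = ((p0 - p) + (\<Sum>i<D. t i *\<^sub>R es i)) \<bullet> \<beta> l)"
        by (rule coord) (use p es in \<open>auto intro!: span_add span_sum span_scale\<close>)
      finally show ?thesis by (simp add: inner_add_left inner_sum_left)
    qed
    then have "e g \<in> S \<longleftrightarrow> (\<exists>t. (\<forall>i<D. 0 \<le> t i) \<and> (\<Sum>i<D. t i) \<le> 1 \<and>
                (\<forall>l<D. g l = (p0 - p) \<bullet> \<beta> l + (\<Sum>i<D. t i * (es i \<bullet> \<beta> l))))" for g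
      unfolding S by blast
    then show "e -` S \<inter> space ?P = {g \<in> extensional {..<D}. \<exists>t. (\<forall>i<D. 0 \<le> t i) \<and> (\<Sum>i<D. t i) \<le> 1 \<and>
                (\<forall>l<D. g l = (p0 - p) \<bullet> \<beta> l + (\<Sum>i<D. t i * (es i \<bullet> \<beta> l)))}"
      by (auto simp: space_PiM PiE_def)
  qed
  finally show ?thesis .
qed

text \<open>The point and the orthonormal basis that \<open>flat_volume\<close> picks by
  \<open>SOME\<close> matter only through their defining properties: the absolute determinant of the
  edge coordinates is the square root of the Gram determinant for every such choice.\<close>

theorem flat_volume_simplex:
  fixes es :: "(real ^ 'm::finite) list"
  assumes "distinct es" and "independent (set es)"
  shows "flat_volume ((+) p0 ` (convex hull (insert 0 (set es)))) = basis_det es / fact (length es)"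
proof -
  define S where "S = (+) p0 ` (convex hull (insert 0 (set es)))"
  define D where "D = length es"
  define W where "W = {x - y | x y. x \<in> S \<and> y \<in> S}"
  define p where "p = (SOME p. p \<in> S)"
  define B where "B = (SOME B. orthonormal_basis_of B W)"
  have nth: "bij_betw ((!) es) {..<D} (set es)" using assms(1) by (simp add: D_def bij_betw_nth)
  have hull: "convex hull (insert 0 (set es)) = {(\<Sum>i<D. t i *\<^sub>R es ! i) | t. (\<forall>i<D. 0 \<le> t i) \<and> (\<Sum>i<D. t i) \<le> 1}"
    (is "_ = ?H")
  proof -
    have z: "0 \<notin> set es" using assms(2) dependent_zero by blast
    have fin: "convex hull (insert 0 (set es)) = {y. \<exists>u. (\<forall>x\<in>insert 0 (set es). 0 \<le> u x) \<and> sum u (insert 0 (set es)) = 1 \<and>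
        (\<Sum>x\<in>insert 0 (set es). u x *\<^sub>R x) = y}"
      by (rule convex_hull_finite) auto
    show ?thesis
    proof (intro Set.set_eqI iffI)
      fix y assume "y \<in> convex hull (insert 0 (set es))"
      then obtain u where u: "\<forall>x\<in>insert 0 (set es). 0 \<le> u x" "sum u (insert 0 (set es)) = 1"
        "(\<Sum>x\<in>insert 0 (set es). u x *\<^sub>R x) = y" unfolding fin by blast
      have "(\<Sum>i<D. u (es ! i)) = sum u (set es)" "(\<Sum>i<D. u (es ! i) *\<^sub>R es ! i) = (\<Sum>x\<in>set es. u x *\<^sub>R x)"
        using sum.reindex_bij_betw[OF nth, of u] sum.reindex_bij_betw[OF nth, of "\<lambda>x. u x *\<^sub>R x"] by auto
      then show "y \<in> ?H"
        using u z by (auto intro!: exI[of _ "\<lambda>i. u (es ! i)"] simp: D_def)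
    next
      fix y assume "y \<in> ?H"
      then obtain t where t: "\<forall>i<D. 0 \<le> t i" "(\<Sum>i<D. t i) \<le> 1" "y = (\<Sum>i<D. t i *\<^sub>R es ! i)" by blast
      \<comment> \<open>The vertex 0 receives the weight that is missing to 1, so coefficients of
        sum at most 1 become barycentric coordinates.\<close>
      define u where "u = (\<lambda>x. if x = 0 then 1 - sum t {..<D} else t (inv_into {..<D} ((!) es) x))"
      have un: "u (es ! i) = t i" if "i < D" for i
        using bij_betw_inv_into_left[OF nth, of i] bij_betw_apply[OF nth, of i] z that by (auto simp: u_def)
      have "(\<Sum>i<D. t i) = sum u (set es)" "(\<Sum>i<D. t i *\<^sub>R es ! i) = (\<Sum>x\<in>set es. u x *\<^sub>R x)"
        using sum.reindex_bij_betw[OF nth, of u] sum.reindex_bij_betw[OF nth, of "\<lambda>x. u x *\<^sub>R x"]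
        by (auto simp: un cong: sum.cong_simp)
      moreover have "0 \<le> u x" if "x \<in> set es" for x
        using that t(1) un by (metis in_set_conv_nth D_def)
      ultimately show "y \<in> convex hull (insert 0 (set es))"
        unfolding fin using z t by (auto intro!: exI[of _ u]) (auto simp: u_def)
    qed
  qed
  have Seq: "S = {p0 + (\<Sum>i<D. t i *\<^sub>R es ! i) | t. (\<forall>i<D. 0 \<le> t i) \<and> (\<Sum>i<D. t i) \<le> 1}"
    unfolding S_def hull by blast
  have "compact S" unfolding S_def
    by (intro compact_translation finite_imp_compact_convex_hull) auto
  then have borel: "S \<in> sets borel" by (simp add: borel_compact)
  have "p0 \<in> S" unfolding S_def by (simp add: hull_inc image_iff)
  then have pS: "p \<in> S" unfolding p_def by (rule someI)
  \<comment> \<open>\<open>flat_volume\<close> takes its basis from all differences of points of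
    \<open>S\<close>; these span the same space as the edges at \<open>p0\<close>.\<close>
  have spanW: "span W = span (set es)"
  proof (rule span_eq[THEN iffD2], intro conjI subsetI)
    fix w assume "w \<in> W"
    then obtain x y where "w = x - y" "x \<in> convex hull (insert 0 (set es))" "y \<in> convex hull (insert 0 (set es))"
      by (auto simp: W_def S_def)
    moreover have "convex hull (insert 0 (set es)) \<subseteq> span (set es)"
      by (intro hull_minimal subspace_imp_convex subspace_span) (auto intro: span_base span_zero)
    ultimately show "w \<in> span (set es)" by (auto intro: span_diff)
  next
    fix e assume "e \<in> set es"
    then have "p0 + e \<in> S" unfolding S_def by (simp add: hull_inc)
    then have "(p0 + e) - p0 \<in> W" using \<open>p0 \<in> S\<close> unfolding W_def by blast
    then have "e \<in> W" by simp
    then show "e \<in> span W" by (rule span_base)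
  qed
  obtain B0 where B0: "orthonormal_basis_of B0 W"
    unfolding orthonormal_basis_of_def
    by (metis orthonormal_basis_subspace[OF subspace_span, of W])
  have "orthonormal_basis_of B W" unfolding B_def by (rule someI[of _ B0]) (rule B0)
  then have B: "pairwise orthogonal B" "\<forall>b\<in>B. norm b = 1" "span B = span (set es)"
    by (auto simp: orthonormal_basis_of_def spanW)
  have "independent B"
    using B by (intro pairwise_orthogonal_independent) auto
  then have "finite B" "card B = dim (span (set es))"
    using B(3) by (auto intro: independent_imp_finite simp: dim_eq_card)
  then have cB: "card B = D" using assms by (simp add: dim_eq_card_independent D_def distinct_card)
  then obtain \<beta> where \<beta>: "bij_betw \<beta> {..<D} B"
    using \<open>finite B\<close> by (metis finite_lessThan card_lessThan finite_same_card_bij)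
  \<comment> \<open>\<open>'m bit0\<close> is only used as an index type of class \<open>wellorder\<close> with at least \<open>D\<close> elements.\<close>
  obtain f where f: "bij_betw f {..<CARD('m bit0)} (UNIV :: 'm bit0 set)"
    by (metis finite_lessThan card_lessThan finite_same_card_bij finite)
  have "D \<le> CARD('m)"
    using independent_card_le[OF assms(2)] distinct_card[OF assms(1)] by (simp add: D_def)
  then have Dn: "D \<le> CARD('m bit0)" by simp
  have esB: "es ! i \<in> span B" if "i < D" for i
    unfolding B(3) using that by (intro span_base) (simp add: D_def)
  have "p0 - p \<in> W" unfolding W_def using \<open>p0 \<in> S\<close> pS by blast
  then have pB: "p0 - p \<in> span B" unfolding B(3) spanW[symmetric] by (rule span_base)
  have "measure (flat_lborel p B) S = \<bar>Determinant.det (Matrix.mat D D (\<lambda>(i, l). es ! i \<bullet> \<beta> l))\<bar> / fact D"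
    by (rule measure_flat_lborel_simplex[OF f Dn B(1,2) \<open>finite B\<close> \<beta> esB pB Seq borel])
  also have "\<bar>Determinant.det (Matrix.mat D D (\<lambda>(i, l). es ! i \<bullet> \<beta> l))\<bar> = basis_det es"
    unfolding basis_det_def D_def[symmetric]
    by (subst det_gram_orthonormal[OF B(1,2) \<open>finite B\<close> \<beta> esB]) auto
  also have "measure (flat_lborel p B) S = flat_volume S"
    unfolding flat_volume_def p_def B_def W_def ..
  finally show ?thesis unfolding S_def D_def .
qed


section \<open>Vertices of unimodular simplices generate the lattice\<close>

lemma independent_nth_zero:
  fixes es :: "'a::euclidean_space list"
  assumes "distinct es" "independent (set es)" and z: "(\<Sum>i<length es. w i *\<^sub>R es ! i) = 0" and i: "i < length es"
  shows "w i = 0"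
proof -
  have nth: "bij_betw ((!) es) {..<length es} (set es)" using assms(1) by (simp add: bij_betw_nth)
  let ?u = "\<lambda>x. w (inv_into {..<length es} ((!) es) x)"
  have un: "?u (es ! j) = w j" if "j < length es" for j
    using bij_betw_inv_into_left[OF nth, of j] that by simp
  have "(\<Sum>x\<in>set es. ?u x *\<^sub>R x) = (\<Sum>i<length es. ?u (es ! i) *\<^sub>R es ! i)"
    by (rule sum.reindex_bij_betw[OF nth, symmetric])
  also have "\<dots> = 0" using z un by (simp cong: sum.cong_simp)
  finally have "?u (es ! i) = 0"
    using assms(2) i by (intro independentD[of "set es" "set es" ?u]) auto
  then show ?thesis using un[OF i] by simp
qed

text \<open>A kernel vector of the Gram matrix gives a combination of the \<open>es ! i\<close> that
  is orthogonal to each of them, hence to itself, hence zero.\<close>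

lemma det_gram_nonzero:
  fixes es :: "'a::euclidean_space list"
  assumes "distinct es" "independent (set es)"
  shows "Determinant.det (Matrix.mat (length es) (length es) (\<lambda>(i, j). es ! i \<bullet> es ! j)) \<noteq> 0"
proof
  let ?n = "length es"
  let ?G = "Matrix.mat ?n ?n (\<lambda>(i, j). es ! i \<bullet> es ! j)"
  assume "Determinant.det ?G = 0"
  then obtain w where w: "w \<in> carrier_vec ?n" "w \<noteq> 0\<^sub>v ?n" "?G *\<^sub>v w = 0\<^sub>v ?n"
    using det_0_iff_vec_prod_zero[of ?G ?n] by auto
  define y where "y = (\<Sum>j<?n. vec_index w j *\<^sub>R es ! j)"
  have "es ! i \<bullet> y = 0" if i: "i < ?n" for i
  proof -
    have "es ! i \<bullet> y = (\<Sum>j = 0..<?n. (es ! i \<bullet> es ! j) * vec_index w j)"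
      by (simp add: y_def inner_sum_right atLeast0LessThan mult.commute)
    also have "\<dots> = vec_index (?G *\<^sub>v w) i" using i w(1) by (simp add: Matrix.scalar_prod_def)
    finally show ?thesis using w(3) i by simp
  qed
  \<comment> \<open>Only the left factor of the inner product is expanded, so that the terms
    \<open>es ! i \<bullet> y\<close>, already known to vanish, appear.\<close>
  then have "y \<bullet> y = 0" unfolding y_def[of, THEN arg_cong[of _ _ "\<lambda>z. z \<bullet> y"]] by (simp add: inner_sum_left)
  then have "y = 0" by simp
  then have "vec_index w i = 0" if "i < ?n" for i
    using independent_nth_zero[OF assms, of "vec_index w"] that by (simp add: y_def)
  then have "w = 0\<^sub>v ?n" using w(1) by (intro eq_vecI) auto
  with w(2) show False by simp
qed

text \<open>Write \<open>es\<close> as an integer matrix \<open>M\<close> applied to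
  \<open>bs\<close>. The Gram determinants then differ by the factor \<open>(det M)^2\<close>, so
  equality forces \<open>det M\<close> to be 1 or -1, and \<open>M\<close> has an integer
  inverse.\<close>

lemma basis_det_eq_generates:
  fixes es bs :: "'a::euclidean_space list"
  assumes bs: "lattice_basis bs L" and es: "distinct es" "independent (set es)" "set es \<subseteq> L"
    and len: "length es = length bs" and eq: "basis_det es = basis_det bs" and x: "x \<in> L"
  shows "\<exists>z :: nat \<Rightarrow> int. x = (\<Sum>i<length es. of_int (z i) *\<^sub>R es ! i)"
proof -
  let ?n = "length bs"
  let ?G = "\<lambda>es. Matrix.mat ?n ?n (\<lambda>(i, j). es ! i \<bullet> es ! j :: real)"
  have L: "L = {\<Sum>i<?n. of_int (c i) *\<^sub>R bs ! i | c :: nat \<Rightarrow> int. True}"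
    and bs': "distinct bs" "independent (set bs)"
    using bs by (auto simp: lattice_basis_def)
  have "\<exists>c :: nat \<Rightarrow> int. es ! i = (\<Sum>j<?n. of_int (c j) *\<^sub>R bs ! j)" if "i < ?n" for i
  proof -
    have "es ! i \<in> L" using that es(3) len nth_mem by auto
    then show ?thesis unfolding L by blast
  qed
  then obtain m :: "nat \<Rightarrow> nat \<Rightarrow> int"
    where m: "es ! i = (\<Sum>j<?n. of_int (m i j) *\<^sub>R bs ! j)" if "i < ?n" for i by metis
  define M where "M = Matrix.mat ?n ?n (\<lambda>(i, j). m i j)"
  have Mc: "M \<in> carrier_mat ?n ?n" by (simp add: M_def)
  define R where "R = (map_mat real_of_int M)"
  have Rc: "R \<in> carrier_mat ?n ?n" by (simp add: R_def M_def)
  have "?G es = R * (?G bs * transpose_mat R)"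
  proof (rule eq_matI)
    fix i j assume "i < dim_row (R * (?G bs * transpose_mat R))" "j < dim_col (R * (?G bs * transpose_mat R))"
    then have ij: "i < ?n" "j < ?n" by (auto simp: R_def M_def)
    have "?G es $$ (i, j) = (\<Sum>k<?n. of_int (m i k) * (\<Sum>l<?n. (bs ! k \<bullet> bs ! l) * of_int (m j l)))"
      using ij by (simp add: m inner_sum_left inner_sum_right sum_distrib_left mult_ac)
    then show "?G es $$ (i, j) = (R * (?G bs * transpose_mat R)) $$ (i, j)"
      using ij by (simp add: R_def M_def Matrix.scalar_prod_def atLeast0LessThan)
  qed (auto simp: R_def M_def)
  moreover have "?G bs * transpose_mat R \<in> carrier_mat ?n ?n"
    using Rc by (intro mult_carrier_mat[of _ ?n ?n]) auto
  ultimately have "Determinant.det (?G es) = Determinant.det R * (Determinant.det (?G bs) * Determinant.det R)"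
    using Determinant.det_mult[OF Rc, of "?G bs * transpose_mat R"]
      Determinant.det_mult[of "?G bs" ?n "transpose_mat R"] Determinant.det_transpose[OF Rc] Rc by simp
  moreover have "Determinant.det (?G es) = Determinant.det (?G bs)"
    using eq len by (simp add: basis_det_def)
  moreover have "Determinant.det (?G bs) \<noteq> 0" by (rule det_gram_nonzero[OF bs'])
  ultimately have "Determinant.det R * Determinant.det R = 1" by (simp add: field_simps)
  moreover have "Determinant.det R = real_of_int (Determinant.det M)"
    unfolding R_def by (rule of_int_hom.hom_det)
  ultimately have "real_of_int (Determinant.det M * Determinant.det M) = 1" by simp
  then have dd: "Determinant.det M * Determinant.det M = 1" using of_int_eq_1_iff by blast
  \<comment> \<open>The inverse of \<open>M\<close> is the adjugate divided by \<open>det M\<close>;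
    as \<open>det M\<close> is its own inverse, multiplying by it does the same and stays in the
    integers.\<close>
  define N where "N = (\<lambda>i j. Determinant.det M * (adj_mat M $$ (i, j)))"
  have NM: "(\<Sum>j<?n. N i j * m j k) = (if i = k then 1 else 0)" if "i < ?n" "k < ?n" for i k
  proof -
    have "(adj_mat M * M) $$ (i, k) = (Determinant.det M \<cdot>\<^sub>m 1\<^sub>m ?n) $$ (i, k)" using adj_mat(3)[OF Mc] by simp
    then have "(\<Sum>j<?n. adj_mat M $$ (i, j) * m j k) = Determinant.det M * (if i = k then 1 else 0)"
      using that adj_mat(1)[OF Mc] by (simp add: M_def Matrix.scalar_prod_def atLeast0LessThan)
    then have "Determinant.det M * (\<Sum>j<?n. adj_mat M $$ (i, j) * m j k) = (if i = k then 1 else 0)"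
      using dd by auto
    then show ?thesis by (simp add: N_def sum_distrib_left mult.assoc)
  qed
  have inv: "bs ! i = (\<Sum>j<?n. of_int (N i j) *\<^sub>R es ! j)" if "i < ?n" for i
  proof -
    have "(\<Sum>j<?n. real_of_int (N i j) *\<^sub>R es ! j) = (\<Sum>j<?n. \<Sum>k<?n. real_of_int (N i j * m j k) *\<^sub>R bs ! k)"
      by (simp add: m scaleR_sum_right)
    also have "\<dots> = (\<Sum>k<?n. real_of_int (\<Sum>j<?n. N i j * m j k) *\<^sub>R bs ! k)"
      by (subst sum.swap) (simp add: scaleR_sum_left)
    also have "\<dots> = (\<Sum>k<?n. if k = i then bs ! k else 0)"
      using NM that by (intro sum.cong) (auto simp del: of_int_sum)
    finally show ?thesis using that by simp
  qed
  obtain c :: "nat \<Rightarrow> int" where "x = (\<Sum>i<?n. of_int (c i) *\<^sub>R bs ! i)" using x unfolding L by blast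
  also have "\<dots> = (\<Sum>i<?n. \<Sum>j<?n. real_of_int (c i * N i j) *\<^sub>R es ! j)"
    by (simp add: inv scaleR_sum_right)
  also have "\<dots> = (\<Sum>j<?n. of_int (\<Sum>i<?n. c i * N i j) *\<^sub>R es ! j)"
    by (subst sum.swap) (simp add: scaleR_sum_left)
  finally show ?thesis unfolding len by (intro exI[of _ "\<lambda>j. \<Sum>i<?n. c i * N i j"])
qed

section \<open>Lattice points in the coordinates of a unimodular simplex\<close>

lemma int_lattice_closed:
  "x \<in> int_lattice \<Longrightarrow> y \<in> int_lattice \<Longrightarrow> x - y \<in> int_lattice"
  "x \<in> int_lattice \<Longrightarrow> of_int k *\<^sub>R x \<in> int_lattice"
  by (auto simp: int_lattice_def)

text \<open>By the volume condition the edges at one vertex have the Gram determinant of a lattice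
  basis, so they generate the lattice. Subtracting \<open>n\<close> times that vertex from
  \<open>x\<close> leaves a lattice vector, whose unique coefficients in the edges are
  integers.\<close>

lemma unimodular_simplex_integral_coordinates:
  fixes P :: "(real ^ 'm::finite) set"
  assumes uni: "unimodular_simplex P S" and zero: "0 \<in> affine hull P"
    and C: "\<not> affine_dependent C" and S: "S = convex hull C"
    and x: "x \<in> affine hull P" "x \<in> int_lattice" "x = (\<Sum>y\<in>C. l y *\<^sub>R y)"
    and l: "sum l C = real_of_int n" and y: "y \<in> C"
  shows "l y \<in> \<int>"
proof -
  define L where "L = affine hull P \<inter> int_lattice"
  have sub: "subspace (affine hull P)" using zero by (simp add: subspace_affine)
  have Lclosed: "u - v \<in> L" "of_int k *\<^sub>R u \<in> L" if "u \<in> L" "v \<in> L" for u v and k :: int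
    using that sub int_lattice_closed by (auto simp: L_def subspace_diff subspace_scale)
  have fin: "finite C" using C by (rule aff_independent_finite)
  have "aff_dim P simplex S" using uni by (simp add: unimodular_simplex_def)
  then have "aff_dim S = aff_dim P" by (rule aff_dim_simplex)
  then have cardC: "int (card C) = aff_dim P + 1"
    using C by (simp add: S aff_dim_convex_hull aff_dim_affine_independent)
  have CL: "C \<subseteq> L"
    using uni extreme_point_of_convex_hull_affine_independent[OF C]
    by (auto simp: unimodular_simplex_def S L_def)
  \<comment> \<open>The vertex in question serves as base point: the other coefficients are read off
    from the edges, and that of \<open>p0\<close> is \<open>n\<close> minus their sum.\<close>
  define p0 where "p0 = y"
  have p0: "p0 \<in> C" using y by (simp add: p0_def)
  define E where "E = (\<lambda>y. y - p0) ` (C - {p0})"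
  have inj: "inj_on (\<lambda>y. y - p0) (C - {p0})" by (auto simp: inj_on_def)
  obtain es where es: "set es = E" "distinct es"
    using finite_distinct_list[of E] fin by (auto simp: E_def)
  have cardE: "card E = card C - 1" unfolding E_def using p0 fin by (simp add: card_image[OF inj])
  then have D: "length es = nat (aff_dim P)" using distinct_card[OF es(2)] es(1) cardC by simp
  have indE: "independent (set es)"
    using C p0 unfolding es(1) E_def by (simp add: affine_dependent_iff_dependent2 uminus_add_conv_diff)
  have "S = (+) p0 ` (convex hull (insert 0 (set es)))"
  proof -
    have "(+) p0 ` (insert 0 (set es)) = C" using p0 by (auto simp: es(1) E_def image_image)
    then show ?thesis by (metis S convex_hull_translation)
  qed
  then have vol: "flat_volume S = basis_det es / fact (length es)"
    using flat_volume_simplex[OF es(2) indE] by simp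
  obtain bs where bs: "lattice_basis bs L" "flat_volume S = basis_det bs / fact (nat (aff_dim P))"
    using uni by (auto simp: unimodular_simplex_def L_def)
  have EL: "set es \<subseteq> L"
    unfolding es(1) E_def using CL p0 by (intro image_subsetI Lclosed(1)) auto
  \<comment> \<open>\<open>lattice_basis\<close> prescribes no length. In one direction
    \<open>es\<close> is independent in the span of \<open>bs\<close>; in the other
    \<open>bs\<close> is independent in the subspace \<open>affine hull P\<close>, of dimension
    \<open>aff_dim P\<close>.\<close>
  have len: "length es = length bs"
  proof (rule antisym)
    have bs': "distinct bs" "independent (set bs)"
      and Leq: "L = {\<Sum>i<length bs. of_int (c i) *\<^sub>R bs ! i | c :: nat \<Rightarrow> int. True}"
      using bs by (auto simp: lattice_basis_def)
    have "L \<subseteq> span (set bs)" unfolding Leq by (auto intro!: span_sum span_scale intro: span_base)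
    then have "card (set es) \<le> card (set bs)"
      using independent_span_bound[OF _ indE, of "set bs"] EL by (meson List.finite_set order_trans)
    then show "length es \<le> length bs" using distinct_card bs'(1) es(2) by metis
    have "set bs \<subseteq> L"
    proof
      fix b assume "b \<in> set bs"
      then obtain k where k: "k < length bs" "b = bs ! k" by (metis in_set_conv_nth)
      then have "b = (\<Sum>i<length bs. of_int (if i = k then 1 else 0) *\<^sub>R bs ! i)"
        by (simp add: if_distrib[of "\<lambda>c. real_of_int c *\<^sub>R _"] cong: if_cong)
      then show "b \<in> L" unfolding Leq by (auto intro!: exI[of _ "\<lambda>i. if i = k then 1 else 0"])
    qed
    then have "card (set bs) \<le> dim (affine hull P)"
      by (intro independent_card_le_dim bs'(2)) (auto simp: L_def)
    also have "int (dim (affine hull P)) = aff_dim P"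
      using aff_dim_subspace[OF sub] by (simp add: aff_dim_affine_hull)
    finally show "length bs \<le> length es" using D bs'(1) by (simp add: distinct_card)
  qed
  have bd: "basis_det es = basis_det bs" using vol bs(2) D by simp
  have gen: "\<exists>z :: nat \<Rightarrow> int. u = (\<Sum>i<length es. of_int (z i) *\<^sub>R es ! i)" if "u \<in> L" for u
    using basis_det_eq_generates[OF bs(1) es(2) indE EL len bd that] .
  have "x \<in> L" "p0 \<in> L" using x(1,2) CL p0 by (auto simp: L_def)
  then have "x - of_int n *\<^sub>R p0 \<in> L" by (intro Lclosed)
  then obtain z :: "nat \<Rightarrow> int" where z: "x - of_int n *\<^sub>R p0 = (\<Sum>i<length es. of_int (z i) *\<^sub>R es ! i)"
    using gen by blast
  have nth: "bij_betw ((!) es) {..<length es} E" using es by (simp add: bij_betw_nth)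
  have bij: "bij_betw (\<lambda>y. y - p0) (C - {p0}) E" using inj by (simp add: bij_betw_def E_def)
  have "x - of_int n *\<^sub>R p0 = (\<Sum>y\<in>C. l y *\<^sub>R (y - p0))"
    by (simp add: x(3) l[symmetric] scaleR_diff_right sum_subtractf scaleR_sum_left)
  also have "\<dots> = (\<Sum>y\<in>C - {p0}. l y *\<^sub>R (y - p0))"
    using fin p0 by (subst sum.remove[of C p0]) auto
  also have "\<dots> = (\<Sum>e\<in>E. l (e + p0) *\<^sub>R e)"
    using sum.reindex_bij_betw[OF bij, of "\<lambda>e. l (e + p0) *\<^sub>R e"] by simp
  also have "\<dots> = (\<Sum>i<length es. l (es ! i + p0) *\<^sub>R es ! i)"
    by (rule sum.reindex_bij_betw[OF nth, symmetric])
  finally have "(\<Sum>i<length es. (l (es ! i + p0) - of_int (z i)) *\<^sub>R es ! i) = 0"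
    using z by (simp add: scaleR_diff_left sum_subtractf)
  then have lz: "l (es ! i + p0) = of_int (z i)" if "i < length es" for i
    using independent_nth_zero[OF es(2) indE _ that, of "\<lambda>i. l (es ! i + p0) - of_int (z i)"] by simp
  have "l u \<in> \<int>" if u: "u \<in> C - {p0}" for u
  proof -
    have "u - p0 \<in> set es" using u by (auto simp: es(1) E_def)
    then obtain i where "i < length es" "es ! i = u - p0" by (metis in_set_conv_nth)
    then show ?thesis using lz[of i] by simp
  qed
  then have "sum l (C - {p0}) \<in> \<int>" by (rule Ints_sum)
  moreover have "l p0 = of_int n - sum l (C - {p0})"
    using l fin p0 by (simp add: sum.remove[of C p0 l])
  ultimately show ?thesis unfolding p0_def[symmetric] by (metis Ints_diff Ints_of_int)
qed


section \<open>Dependencies and decompositions\<close>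

text \<open>Raising one entry of \<open>lo\<close> by 1 raises the sum by 1, so every intermediate
  sum is reached. It serves to find vectors below \<open>b\<close> with half the sum of
  \<open>b\<close> and prescribed bounds on some entries.\<close>

lemma integer_interpolation:
  fixes lo hi :: "'s::finite \<Rightarrow> int"
  assumes "\<And>i. lo i \<le> hi i" and "sum lo UNIV \<le> k" and "k \<le> sum hi UNIV"
  obtains c where "\<And>i. lo i \<le> c i" "\<And>i. c i \<le> hi i" "sum c UNIV = k"
proof -
  have "\<exists>c. (\<forall>i. lo i \<le> c i \<and> c i \<le> hi i) \<and> sum c UNIV = k"
    using assms
  proof (induction "nat (k - sum lo UNIV)" arbitrary: lo)
    case 0
    then have "sum lo UNIV = k" by linarith
    then show ?case using 0 by blast
  next
    case (Suc m)
    have "\<exists>i. lo i < hi i"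
    proof (rule ccontr)
      assume "\<not> (\<exists>i. lo i < hi i)"
      then have "sum hi UNIV \<le> sum lo UNIV" by (intro sum_mono) (auto simp: not_less)
      then show False using Suc by linarith
    qed
    then obtain i where i: "lo i < hi i" by blast
    define lo' where "lo' = lo(i := lo i + 1)"
    have s: "sum lo' UNIV = sum lo UNIV + 1"
      unfolding lo'_def by (subst (1 2) sum.remove[of UNIV i]) (auto intro!: sum.cong)
    have "\<exists>c. (\<forall>i. lo' i \<le> c i \<and> c i \<le> hi i) \<and> sum c UNIV = k"
    proof (rule Suc(1))
      show "m = nat (k - sum lo' UNIV)" using Suc(2) s by linarith
      show "lo' j \<le> hi j" for j using Suc(3)[of j] i by (auto simp: lo'_def)
      show "sum lo' UNIV \<le> k" using Suc(2) s by linarith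
    qed (rule Suc(5))
    then obtain c where c: "\<forall>i. lo' i \<le> c i \<and> c i \<le> hi i" "sum c UNIV = k" by blast
    have "lo j \<le> lo' j" for j by (simp add: lo'_def)
    with c have "lo j \<le> c j \<and> c j \<le> hi j" for j using order_trans[of "lo j" "lo' j" "c j"] by blast
    with c(2) show ?case by blast
  qed
  then show thesis using that by blast
qed

text \<open>The two assumptions on \<open>Vs\<close>, the vertex sets of the simplices of a unimodular triangulation,
  say that integer points of a dilate of the polytope decompose into vertices of a single simplex,
  and that convex combinations of vertices of two simplices agree only if they share a vertex.\<close>

lemma circuit_no_decomposition:
  fixes v :: "'s::finite \<Rightarrow> 'a::real_vector" and b :: "'s \<Rightarrow> int" and Vs :: "'a set set"
  assumes ker: "\<And>c. (\<Sum>i\<in>UNIV. c i *\<^sub>R v i) = 0 \<Longrightarrow> \<exists>t. \<forall>i. c i = t * real_of_int (b i)"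
    and dep: "(\<Sum>i\<in>UNIV. real_of_int (b i) *\<^sub>R v i) = 0"
    and nonneg: "\<And>i. 0 \<le> b i"
    and prim: "\<And>t::real. (\<And>i. t * real_of_int (b i) \<in> \<int>) \<Longrightarrow> t \<in> \<int>"
    and even: "even (sum b UNIV)"
    and big: "b j \<ge> 2"
    and rep: "\<And>(n::nat) c c'. n \<ge> 1 \<Longrightarrow>
        (\<Sum>i\<in>UNIV. real_of_int (c i) *\<^sub>R v i) = (\<Sum>i\<in>UNIV. c' i *\<^sub>R v i) \<Longrightarrow>
        (\<Sum>i\<in>UNIV. \<bar>c' i\<bar>) \<le> real n \<Longrightarrow>
        \<exists>V\<in>Vs. \<exists>d. (\<Sum>i\<in>UNIV. real_of_int (d i) *\<^sub>R v i) = (\<Sum>i\<in>UNIV. real_of_int (c i) *\<^sub>R v i) \<and>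
          (\<Sum>i\<in>UNIV. \<bar>d i\<bar>) \<le> int n \<and> (\<forall>i. d i > 0 \<longrightarrow> v i \<in> V) \<and> (\<forall>i. d i < 0 \<longrightarrow> - v i \<in> V)"
    and crossing: "\<And>V W c e. V \<in> Vs \<Longrightarrow> W \<in> Vs \<Longrightarrow> (\<And>i. 0 \<le> (c i::int)) \<Longrightarrow> (\<And>i. 0 \<le> (e i::int)) \<Longrightarrow>
        (\<And>i. c i > 0 \<Longrightarrow> v i \<in> V) \<Longrightarrow> (\<And>i. e i > 0 \<Longrightarrow> - v i \<in> W) \<Longrightarrow>
        sum c UNIV = sum e UNIV \<Longrightarrow> sum c UNIV > 0 \<Longrightarrow>
        (\<Sum>i\<in>UNIV. real_of_int (c i) *\<^sub>R v i) = - (\<Sum>i\<in>UNIV. real_of_int (e i) *\<^sub>R v i) \<Longrightarrow> False"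
  shows False
proof -
  obtain k where k: "sum b UNIV = 2 * k" using even by blast
  have "b j \<le> sum b UNIV" using nonneg by (intro member_le_sum) auto
  \<comment> \<open>Otherwise the sum of \<open>b\<close> is 2, so \<open>b j = 2\<close> is the
    only nonzero entry and the factor 1/2 contradicts \<open>prim\<close>.\<close>
  have k2: "k \<ge> 2"
  proof (rule ccontr)
    assume "\<not> k \<ge> 2"
    with \<open>b j \<le> sum b UNIV\<close> big k have "sum b UNIV = b j" "b j = 2" by auto
    then have "sum b (UNIV - {j}) = 0" by (simp add: sum.remove[of UNIV j b])
    then have "b i = 0" if "i \<noteq> j" for i
      using that nonneg by (subst (asm) sum_nonneg_eq_0_iff) auto
    then have "(1/2) * real_of_int (b i) \<in> \<int>" for i
      using \<open>b j = 2\<close> by (cases "i = j") auto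
    then have "(1/2::real) \<in> \<int>" by (rule prim)
    then show False by (auto elim!: Ints_cases)
  qed
  have shift: "\<exists>t::int. \<forall>i. d i = c i + t * b i"
    if eq: "(\<Sum>i\<in>UNIV. real_of_int (d i) *\<^sub>R v i) = (\<Sum>i\<in>UNIV. real_of_int (c i) *\<^sub>R v i)" for d c :: "'s \<Rightarrow> int"
  proof -
    have "(\<Sum>i\<in>UNIV. (real_of_int (d i) - real_of_int (c i)) *\<^sub>R v i) = 0"
      using eq by (simp add: scaleR_left_diff_distrib sum_subtractf)
    from ker[OF this] obtain t where t: "\<And>i. real_of_int (d i) - real_of_int (c i) = t * real_of_int (b i)"
      by blast
    have "t \<in> \<int>" by (rule prim) (simp add: t[symmetric])
    then obtain z where "t = of_int z" by (rule Ints_cases)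
    then have "real_of_int (d i) = real_of_int (c i + z * b i)" for i using t[of i] by simp
    then show ?thesis unfolding of_int_eq_iff by blast
  qed
  have lower: "\<bar>sum c UNIV + 2 * k * t\<bar> \<le> (\<Sum>i\<in>UNIV. \<bar>d i\<bar>)"
    if "\<forall>i. d i = c i + t * b i" for d c :: "'s \<Rightarrow> int" and t
  proof -
    have "sum d UNIV = sum c UNIV + t * sum b UNIV"
      using that by (simp add: sum.distrib sum_distrib_left)
    then have "sum d UNIV = sum c UNIV + 2 * k * t" by (simp add: k algebra_simps)
    then show ?thesis using sum_abs[of d UNIV] by simp
  qed
  \<comment> \<open>The sum of the vectors over \<open>I\<close>, with sign \<open>s\<close>, has
    norm \<open>card I\<close>. A representation shifted by \<open>t \<noteq> 0\<close> has norm at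
    least \<open>2 * k - card I\<close>, which exceeds \<open>card I\<close>; so the decomposition
    into vertices of one simplex is the given one.\<close>
  have face: "\<exists>V\<in>Vs. \<forall>i\<in>I. of_int s *\<^sub>R v i \<in> V"
    if I: "I \<noteq> {}" "int (card I) < k" and s: "s = 1 \<or> s = (-1::int)" for I :: "'s set" and s
  proof -
    define c where "c = (\<lambda>i. if i \<in> I then s else 0)"
    have c1: "(\<Sum>i\<in>UNIV. \<bar>c i\<bar>) = int (card I)"
      using s by (auto simp: c_def if_distrib sum.If_cases cong: if_cong)
    have c0: "sum c UNIV = s * int (card I)"
      by (simp add: c_def sum.If_cases)
    have "\<exists>V\<in>Vs. \<exists>d. (\<Sum>i\<in>UNIV. real_of_int (d i) *\<^sub>R v i) = (\<Sum>i\<in>UNIV. real_of_int (c i) *\<^sub>R v i) \<and>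
          (\<Sum>i\<in>UNIV. \<bar>d i\<bar>) \<le> int (card I) \<and> (\<forall>i. d i > 0 \<longrightarrow> v i \<in> V) \<and> (\<forall>i. d i < 0 \<longrightarrow> - v i \<in> V)"
    proof (rule rep[OF _ refl])
      show "1 \<le> card I" using I by (simp add: Suc_leI card_gt_0_iff)
      have "(\<Sum>i\<in>UNIV. \<bar>real_of_int (c i)\<bar>) = real_of_int (\<Sum>i\<in>UNIV. \<bar>c i\<bar>)" by simp
      then show "(\<Sum>i\<in>UNIV. \<bar>real_of_int (c i)\<bar>) \<le> real (card I)" by (simp only: c1)
    qed
    then obtain V d where V: "V \<in> Vs"
      and d: "(\<Sum>i\<in>UNIV. real_of_int (d i) *\<^sub>R v i) = (\<Sum>i\<in>UNIV. real_of_int (c i) *\<^sub>R v i)"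
        "(\<Sum>i\<in>UNIV. \<bar>d i\<bar>) \<le> int (card I)" "\<And>i. d i > 0 \<Longrightarrow> v i \<in> V" "\<And>i. d i < 0 \<Longrightarrow> - v i \<in> V"
      by blast
    obtain t where t: "\<forall>i. d i = c i + t * b i" using shift[OF d(1)] by blast
    have le: "\<bar>s * int (card I) + 2 * k * t\<bar> \<le> int (card I)"
      using lower[OF t] d(2) c0 by simp
    have "t = 0"
    proof (rule ccontr)
      assume "t \<noteq> 0"
      then have "k \<le> k * \<bar>t\<bar>" using k2 by (simp add: mult_le_cancel_left1)
      moreover have "\<bar>2 * k * t\<bar> = 2 * (k * \<bar>t\<bar>)" using k2 by (simp add: abs_mult)
      moreover have "\<bar>s * int (card I)\<bar> = int (card I)" using s by auto
      ultimately show False using le I(2) by linarith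
    qed
    then have "d i = c i" for i using t by simp
    then have "of_int s *\<^sub>R v i \<in> V" if "i \<in> I" for i
      using d(3)[of i] d(4)[of i] that s by (auto simp: c_def)
    then show ?thesis using V by blast
  qed
  have small: "int (card {i. c i > 0}) < sum c UNIV"
    if c: "\<And>i. 0 \<le> c i" and l: "c l \<ge> 2" for c :: "'s \<Rightarrow> int" and l
  proof -
    have "int (card {i. c i > 0}) = (\<Sum>i\<in>UNIV. if c i > 0 then 1 else 0)"
      by (simp add: sum.If_cases)
    also have "\<dots> < sum c UNIV"
    proof (rule sum_strict_mono_ex1)
      show "\<forall>x\<in>UNIV. (if 0 < c x then 1 else 0) \<le> c x" using c by auto
      show "\<exists>a\<in>UNIV. (if 0 < c a then 1 else 0) < c a" using l by (intro bexI[of _ l]) auto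
    qed simp
    finally show ?thesis .
  qed
  have case1: False
    if c: "\<And>i. 0 \<le> c i" "\<And>i. c i \<le> b i" "sum c UNIV = k" and i: "c i \<ge> 2" and l: "b l - c l \<ge> 2"
    for c :: "'s \<Rightarrow> int" and i l
  proof -
    define e where "e = (\<lambda>i. b i - c i)"
    have e: "\<And>i. 0 \<le> e i" "sum e UNIV = k" "e l \<ge> 2"
      using c l k by (auto simp: e_def sum_subtractf)
    obtain V where V: "V \<in> Vs" "\<And>i. c i > 0 \<Longrightarrow> v i \<in> V"
      proof -
      have "{x. c x > 0} \<noteq> {}" using i by (auto intro!: exI[of _ i])
      moreover have "int (card {x. c x > 0}) < k" using small[of c i] c(1,3) i by simp
      ultimately show ?thesis using face[of "{x. c x > 0}" 1] that by auto
    qed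
    obtain W where W: "W \<in> Vs" "\<And>i. e i > 0 \<Longrightarrow> - v i \<in> W"
      proof -
      have "{x. e x > 0} \<noteq> {}" using e(3) by (auto intro!: exI[of _ l])
      moreover have "int (card {x. e x > 0}) < k" using small[of e l] e by simp
      ultimately show ?thesis using face[of "{x. e x > 0}" "-1"] that by auto
    qed
    show False
    proof (rule crossing[OF V(1) W(1) c(1) e(1) V(2) W(2)])
      have "(\<Sum>i\<in>UNIV. real_of_int (c i) *\<^sub>R v i) + (\<Sum>i\<in>UNIV. real_of_int (e i) *\<^sub>R v i) = 0"
        by (simp add: e_def dep flip: sum.distrib scaleR_left_distrib)
      then show "(\<Sum>i\<in>UNIV. real_of_int (c i) *\<^sub>R v i) = - (\<Sum>i\<in>UNIV. real_of_int (e i) *\<^sub>R v i)"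
        by (simp add: eq_neg_iff_add_eq_0)
    qed (use c e k2 in auto)
  qed
  \<comment> \<open>The lower bound reserves 2 at \<open>i\<close> for \<open>c\<close>, the upper
    bound reserves 2 at \<open>l\<close> for \<open>b - c\<close>. The bounds are compatible if
    \<open>i\<close> and \<open>l\<close> differ or the common entry is at least 4, and their sums 2
    and \<open>2 * k - 2\<close> enclose \<open>k\<close>.\<close>
  have two: False if "lo = (\<lambda>x. if x = i then 2 else 0)" "hi = (\<lambda>x. if x = l then b l - 2 else b x)"
    "b i \<ge> 2" "b l \<ge> 2" "i \<noteq> l \<or> b i \<ge> 4" for i l and lo hi :: "'s \<Rightarrow> int"
  proof -
    have 1: "lo x \<le> hi x" for x using that nonneg[of x] by auto
    have 2: "sum lo UNIV \<le> k" using that k2 by simp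
    have "hi = (\<lambda>x. b x - (if x = l then 2 else 0))" using that by auto
    then have "sum hi UNIV = sum b UNIV - 2" by (simp add: sum_subtractf)
    then have 3: "k \<le> sum hi UNIV" using k k2 by simp
    obtain c where c: "\<And>x. lo x \<le> c x" "\<And>x. c x \<le> hi x" "sum c UNIV = k"
      using integer_interpolation[OF 1 2 3] by blast
    show False
    proof (rule case1[of c i l])
      show "0 \<le> c x" "c x \<le> b x" for x using c(1,2)[of x] that by (auto split: if_splits)
      show "c i \<ge> 2" using c(1)[of i] that by auto
      show "b l - c l \<ge> 2" using c(2)[of l] that by auto
    qed fact
  qed
  have one: "b i \<le> 1" if "i \<noteq> j" for i using two[OF refl refl, of i j] that big by (cases "b i \<ge> 2") auto
  have bj: "b j \<le> 3" using two[OF refl refl, of j j] big by (cases "b j \<ge> 4") auto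
  \<comment> \<open>Both bounds agree at \<open>j\<close> and fix \<open>c j = b j - 1\<close>. As
    \<open>b j\<close> is 2 or 3, the distance of this value from \<open>b j / 2\<close> is
    \<open>b j / 2 - 1\<close>, a gain of 1 over the distance \<open>b i / 2\<close> at the other
    entries.\<close>
  obtain c where c: "\<And>x. (if x = j then b j - 1 else 0) \<le> c x" "\<And>x. c x \<le> (if x = j then b j - 1 else b x)"
     "sum c UNIV = k"
  proof (rule integer_interpolation[of "\<lambda>x. if x = j then b j - 1 else 0" "\<lambda>x. if x = j then b j - 1 else b x" k])
    have "(\<Sum>x\<in>UNIV. if x = j then b j - 1 else b x) = (\<Sum>x\<in>UNIV. b x - (if x = j then 1 else 0))"
      by (rule sum.cong) auto
    then have "(\<Sum>x\<in>UNIV. if x = j then b j - 1 else b x) = 2 * k - 1" by (simp add: sum_subtractf k)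
    then show "k \<le> (\<Sum>x\<in>UNIV. if x = j then b j - 1 else b x)" using k2 by simp
  qed (use nonneg bj k2 in auto)
  \<comment> \<open>Only \<open>b j\<close> exceeds 1, so subtracting \<open>b / 2\<close> brings \<open>c\<close> down to norm \<open>k - 1\<close>, which no integer shift does.\<close>
  define c' where "c' = (\<lambda>i. real_of_int (c i) - real_of_int (b i) / 2)"
  have "\<bar>c' i\<bar> = real_of_int (b i) / 2 - (if i = j then 1 else 0)" for i
  proof (cases "i = j")
    case True
    then show ?thesis using c(1,2)[of j] big bj by (auto simp: c'_def)
  next
    case False
    then have "b i = 0 \<or> b i = 1" "0 \<le> c i" "c i \<le> b i" using one[of i] nonneg[of i] c(1,2)[of i] by auto
    then have "(b i = 0 \<and> c i = 0) \<or> (b i = 1 \<and> c i = 0) \<or> (b i = 1 \<and> c i = 1)" by linarith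
    then show ?thesis using False by (auto simp: c'_def)
  qed
  then have "(\<Sum>i\<in>UNIV. \<bar>c' i\<bar>) = real_of_int (sum b UNIV) / 2 - 1"
    by (simp add: sum_subtractf sum_divide_distrib)
  then have n': "(\<Sum>i\<in>UNIV. \<bar>c' i\<bar>) \<le> real (nat (k - 1))" using k k2 by simp
  have "(\<Sum>i\<in>UNIV. c' i *\<^sub>R v i) = (\<Sum>i\<in>UNIV. real_of_int (c i) *\<^sub>R v i) - (1/2) *\<^sub>R (\<Sum>i\<in>UNIV. real_of_int (b i) *\<^sub>R v i)"
    unfolding c'_def scaleR_right.sum by (simp add: sum_subtractf scaleR_left_diff_distrib)
  then have eq: "(\<Sum>i\<in>UNIV. real_of_int (c i) *\<^sub>R v i) = (\<Sum>i\<in>UNIV. c' i *\<^sub>R v i)" by (simp add: dep)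
  have n1: "1 \<le> nat (k - 1)" using k2 by simp
  obtain d where d: "(\<Sum>i\<in>UNIV. real_of_int (d i) *\<^sub>R v i) = (\<Sum>i\<in>UNIV. real_of_int (c i) *\<^sub>R v i)"
     "(\<Sum>i\<in>UNIV. \<bar>d i\<bar>) \<le> int (nat (k - 1))"
    using rep[OF n1 eq n'] by blast
  obtain t where t: "\<forall>i. d i = c i + t * b i" using shift[OF d(1)] by blast
  have "\<bar>k + 2 * k * t\<bar> \<le> k - 1" using lower[OF t] d(2) c(3) k2 by simp
  moreover have "k + 2 * k * t = k * (1 + 2 * t)" by (simp add: algebra_simps)
  then have "\<bar>k + 2 * k * t\<bar> = k * \<bar>1 + 2 * t\<bar>" using k2 by (simp add: abs_mult)
  \<comment> \<open>\<open>1 + 2 * t\<close> is odd, hence of absolute value at least 1.\<close>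
  moreover have "k * 1 \<le> k * \<bar>1 + 2 * t\<bar>" using k2 by (intro mult_left_mono) presburger+
  ultimately show False by linarith
qed


section \<open>Unimodular triangulations\<close>

text \<open>The kernel is the orthogonal complement of the row space, whose dimension is the
  rank.\<close>

lemma dim_null_space:
  fixes A :: "real ^ 'n ^ 'm"
  shows "dim {x. A *v x = 0} + rank A = CARD('n)"
proof -
  have "A *v y = 0 \<longleftrightarrow> (\<forall>x\<in>span (rows A). orthogonal x y)" for y
  proof
    assume "A *v y = 0"
    then have "A $ i \<bullet> y = 0" for i by (metis matrix_mult_dot vec_lambda_beta zero_index)
    then have "orthogonal y x" if "x \<in> rows A" for x
      using that by (auto simp: rows_def row_def orthogonal_def inner_commute)
    then show "\<forall>x\<in>span (rows A). orthogonal x y"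
      using orthogonal_to_span orthogonal_commute by blast
  next
    assume "\<forall>x\<in>span (rows A). orthogonal x y"
    then have "orthogonal (row i A) y" for i by (auto simp: rows_def intro: span_base)
    then show "A *v y = 0" by (simp add: row_def matrix_mult_dot vec_eq_iff orthogonal_def)
  qed
  then have "{x. A *v x = 0} = {y \<in> UNIV. \<forall>x\<in>span (rows A). orthogonal x y}" by auto
  then show ?thesis
    using dim_subspace_orthogonal_to_vectors[of "span (rows A)" "UNIV :: (real ^ 'n) set"]
    by (simp add: row_rank_def)
qed

text \<open>The common point lies in the relative interior of \<open>convex hull F\<close> and in
  the common face of the two simplices, so that face contains all of \<open>F\<close>. Extreme
  points of a face are extreme in both simplices, so \<open>F\<close> consists of vertices of
  \<open>E\<close> as well, and disjoint \<open>F\<close> and \<open>G\<close> would give one point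
  two barycentric representations over \<open>E\<close>.\<close>

lemma simplicial_complex_unique_combination:
  fixes T :: "'a::euclidean_space set set"
  assumes T: "simplicial_complex T" "convex hull C \<in> T" "convex hull E \<in> T"
    and C: "\<not> affine_dependent C" and E: "\<not> affine_dependent E"
    and F: "F \<subseteq> C" "\<And>x. x \<in> F \<Longrightarrow> \<alpha> x > 0" "sum \<alpha> F = 1"
    and G: "G \<subseteq> E" "\<And>x. x \<in> G \<Longrightarrow> \<beta> x > 0" "sum \<beta> G = 1"
    and eq: "(\<Sum>x\<in>F. \<alpha> x *\<^sub>R x) = (\<Sum>x\<in>G. \<beta> x *\<^sub>R x)"
  shows "F \<inter> G \<noteq> {}"
proof
  assume disj: "F \<inter> G = {}"
  define p where "p = (\<Sum>x\<in>F. \<alpha> x *\<^sub>R x)"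
  let ?I = "convex hull C \<inter> convex hull E"
  have fC: "?I face_of convex hull C" and fE: "?I face_of convex hull E"
    using T unfolding simplicial_complex_def by (blast, metis inf_commute)
  have "\<not> affine_dependent F" using C F(1) affine_dependent_subset by blast
  then have pF: "p \<in> rel_interior (convex hull F)"
    unfolding rel_interior_convex_hull_explicit[OF \<open>\<not> affine_dependent F\<close>] using F by (auto simp: p_def)
  have "\<not> affine_dependent G" using E G(1) affine_dependent_subset by blast
  then have "p \<in> rel_interior (convex hull G)"
    unfolding rel_interior_convex_hull_explicit[OF \<open>\<not> affine_dependent G\<close>] using G eq by (auto simp: p_def)
  then have "p \<in> convex hull G" by (rule subsetD[OF rel_interior_subset])
  then have "p \<in> convex hull E" by (rule subsetD[OF hull_mono[OF G(1)]])
  moreover have "p \<in> convex hull F" by (rule subsetD[OF rel_interior_subset pF])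
  then have "p \<in> convex hull C" by (rule subsetD[OF hull_mono[OF F(1)]])
  ultimately have "?I \<inter> rel_interior (convex hull F) \<noteq> {}" using pF by auto
  then have "convex hull F \<subseteq> ?I"
    by (intro subset_of_face_of[OF fC] hull_mono F(1))
  with hull_subset have "F \<subseteq> ?I" by (rule order_trans)
  have FE: "F \<subseteq> E"
  proof
    fix x assume "x \<in> F"
    then have "x extreme_point_of convex hull C" "x \<in> ?I"
      using F(1) \<open>F \<subseteq> ?I\<close> C by (auto simp: extreme_point_of_convex_hull_affine_independent)
    then have "x extreme_point_of ?I" using extreme_point_of_face[OF fC] by blast
    then have "x extreme_point_of convex hull E" using extreme_point_of_face[OF fE] by blast
    then show "x \<in> E" using E by (simp add: extreme_point_of_convex_hull_affine_independent)
  qed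
  \<comment> \<open>The difference of the two representations; since \<open>F\<close> and
    \<open>G\<close> are taken to be disjoint, nothing cancels and \<open>u\<close> is a nontrivial
    affine dependency of \<open>E\<close>.\<close>
  define u where "u = (\<lambda>x. if x \<in> F then \<alpha> x else if x \<in> G then - \<beta> x else 0)"
  have finE: "finite E" using E by (rule aff_independent_finite)
  then have fin: "finite F" "finite G" using FE G(1) finite_subset by auto
  have split: "(\<Sum>x\<in>E. h x) = (\<Sum>x\<in>F. h x) + (\<Sum>x\<in>G. h x)"
    if "\<And>x. x \<notin> F \<union> G \<Longrightarrow> h x = 0" for h :: "'a \<Rightarrow> 'b::comm_monoid_add"
  proof -
    have "(\<Sum>x\<in>E. h x) = (\<Sum>x\<in>F \<union> G. h x)"
      using FE G(1) that finE by (intro sum.mono_neutral_right) auto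
    then show ?thesis using disj fin by (simp add: sum.union_disjoint)
  qed
  have uG: "x \<in> G \<Longrightarrow> u x = - \<beta> x" for x using disj by (auto simp: u_def)
  have uF: "x \<in> F \<Longrightarrow> u x = \<alpha> x" for x by (auto simp: u_def)
  have u0: "x \<notin> F \<union> G \<Longrightarrow> u x = 0" for x by (auto simp: u_def)
  have "sum u E = 0" using F(3) G(3)
    by (subst split[OF u0]) (simp_all add: uF uG sum_negf cong: sum.cong_simp)
  moreover have "(\<Sum>x\<in>E. u x *\<^sub>R x) = 0" using eq
    by (subst split) (simp_all add: u0[simplified] uF uG sum_negf cong: sum.cong_simp)
  moreover have "\<exists>x\<in>E. u x \<noteq> 0"
  proof -
    have "F \<noteq> {}" using F(3) by auto
    then obtain x where "x \<in> F" by blast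
    then show ?thesis using FE F(2)[of x] by (auto simp: uF intro!: bexI[of _ x])
  qed
  ultimately have "affine_dependent E" using affine_dependent_explicit_finite[OF finE] by blast
  with E show False by blast
qed

section \<open>Integer decomposition in a unimodularly triangulated polytope\<close>

lemma convex_sum_with_zero:
  assumes "convex P" "0 \<in> P" "finite I" "\<And>i. i \<in> I \<Longrightarrow> p i \<in> P" "\<And>i. i \<in> I \<Longrightarrow> 0 \<le> w i" "sum w I \<le> 1"
  shows "(\<Sum>i\<in>I. w i *\<^sub>R p i) \<in> P"
proof (cases "sum w I = 0")
  case True
  then have "w i = 0" if "i \<in> I" for i using assms(3,5) that by (simp add: sum_nonneg_eq_0_iff)
  then show ?thesis using assms(2) by simp
next
  case False
  let ?s = "sum w I"
  have s: "0 < ?s" using False assms(5) by (simp add: order_less_le sum_nonneg)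
  have "(\<Sum>i\<in>I. (w i / ?s) *\<^sub>R p i) \<in> P"
    using assms s by (intro convex_sum) (auto simp: sum_divide_distrib[symmetric])
  then have "?s *\<^sub>R (\<Sum>i\<in>I. (w i / ?s) *\<^sub>R p i) + (1 - ?s) *\<^sub>R 0 \<in> P"
    using assms s by (intro convexD) auto
  then show ?thesis using False by (simp add: scaleR_sum_right)
qed

text \<open>Scale \<open>x\<close> into the polytope and take its barycentric coordinates in a
  maximal simplex. Multiplied by \<open>n\<close> they have sum \<open>n\<close> and represent the
  lattice point \<open>x\<close>, so unimodularity makes them integers.\<close>

lemma unimodular_triangulation_integral_decomposition:
  fixes T :: "(real ^ 'm::finite) set set"
  assumes T: "unimodular_triangulation_of T P" and P: "convex P" "0 \<in> P"
    and n: "n \<ge> (1::nat)" and x: "x \<in> int_lattice" "(1 / real n) *\<^sub>R x \<in> P"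
  obtains C m where "convex hull C \<in> T" "\<not> affine_dependent C" "C \<subseteq> P \<inter> int_lattice"
    "\<forall>y\<in>C. 0 \<le> (m y :: int)" "sum m C = int n" "(\<Sum>y\<in>C. of_int (m y) *\<^sub>R y) = x"
proof -
  have sc: "simplicial_complex T" and UT: "\<Union>T = P"
    and uni: "\<And>S. S \<in> maximal_simplices T \<Longrightarrow> unimodular_simplex P S"
    using T by (auto simp: unimodular_triangulation_of_def triangulation_of_def)
  obtain S0 where S0: "S0 \<in> T" "(1 / real n) *\<^sub>R x \<in> S0" using x(2) UT by blast
  have "finite T" using sc by (simp add: simplicial_complex_def)
  \<comment> \<open>Unimodularity is stated for maximal simplices; finiteness of \<open>T\<close>
    yields one that contains \<open>S0\<close>.\<close>
  then obtain S where S: "S \<in> T" "S0 \<subseteq> S" "\<forall>S'\<in>T. S \<subseteq> S' \<longrightarrow> S = S'"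
    using finite_has_maximal2[OF _ S0(1)] by blast
  then have "S \<in> maximal_simplices T" unfolding maximal_simplices_def by blast
  note uS = uni[OF this]
  obtain C where C: "\<not> affine_dependent C" "S = convex hull C"
    using uS unfolding unimodular_simplex_def simplex_def by blast
  have fin: "finite C" using C(1) by (rule aff_independent_finite)
  have CP: "C \<subseteq> P \<inter> int_lattice"
    using uS extreme_point_of_convex_hull_affine_independent[OF C(1)] UT S(1) hull_subset[of C convex] C(2)
    unfolding unimodular_simplex_def by blast
  obtain l where l: "\<forall>y\<in>C. 0 \<le> l y" "sum l C = 1" "(\<Sum>y\<in>C. l y *\<^sub>R y) = (1 / real n) *\<^sub>R x"
    using S0(2) S(2) unfolding C(2) convex_hull_finite[OF fin] by blast
  have x': "x = (\<Sum>y\<in>C. (real n * l y) *\<^sub>R y)"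
    using arg_cong[OF l(3), of "\<lambda>z. real n *\<^sub>R z"] n by (simp add: scaleR_sum_right)
  have zero: "0 \<in> affine hull P" using P by (simp add: hull_inc)
  then have sub: "subspace (affine hull P)" by (simp add: subspace_affine)
  have "real n *\<^sub>R ((1 / real n) *\<^sub>R x) \<in> affine hull P"
    using x(2) by (intro subspace_scale[OF sub] hull_inc)
  then have xa: "x \<in> affine hull P" using n by simp
  have "real n * l y \<in> \<int>" if "y \<in> C" for y
    using unimodular_simplex_integral_coordinates[OF uS zero C(1,2) xa x(1) x' _ that, of "int n"] l(2)
    by (simp add: sum_distrib_left[symmetric])
  then have m: "real_of_int \<lfloor>real n * l y\<rfloor> = real n * l y" if "y \<in> C" for y
    using that by simp
  show thesis
  proof (rule that)
    show "convex hull C \<in> T" using S C by simp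
    show "\<forall>y\<in>C. 0 \<le> \<lfloor>real n * l y\<rfloor>" using l by simp
    have "real_of_int (\<Sum>y\<in>C. \<lfloor>real n * l y\<rfloor>) = real_of_int (int n)"
      using l(2) by (simp add: m sum_distrib_left[symmetric] cong: sum.cong_simp)
    then show "(\<Sum>y\<in>C. \<lfloor>real n * l y\<rfloor>) = int n" by (simp only: of_int_eq_iff)
    show "(\<Sum>y\<in>C. of_int \<lfloor>real n * l y\<rfloor> *\<^sub>R y) = x"
      unfolding x' by (intro sum.cong) (auto simp: m)
  qed fact+
qed

section \<open>The kernel of a matrix of corank one\<close>

text \<open>For a non-integer \<open>t\<close>, the fractional part of \<open>t\<close> times
  \<open>a\<close> would be a shorter integer dependency with the same signs, contrary to
  minimality. Thus the entries of \<open>a\<close> have no common divisor above 1.\<close>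

lemma minimal_dependency_primitive:
  fixes A :: "int ^ 's ^ 'm" and t :: real
  assumes a: "minimal_dependency A a" and t: "\<And>i. t * real_of_int (a $ i) \<in> \<int>"
  shows "t \<in> \<int>"
proof (rule ccontr)
  assume "t \<notin> \<int>"
  define r where "r = frac t"
  have r: "0 < r" "r < 1" using \<open>t \<notin> \<int>\<close> by (auto simp: r_def frac_gt_0_iff frac_lt_1)
  have "r * real_of_int (a $ i) = t * real_of_int (a $ i) - real_of_int (\<lfloor>t\<rfloor> * a $ i)" for i
    by (simp add: r_def frac_def algebra_simps)
  then have "r * real_of_int (a $ i) \<in> \<int>" for i using t by (metis Ints_diff Ints_of_int)
  then have fl: "real_of_int \<lfloor>r * real_of_int (a $ i)\<rfloor> = r * real_of_int (a $ i)" for i by simp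
  define a' where "a' = (\<chi> i. \<lfloor>r * real_of_int (a $ i)\<rfloor>)"
  have a': "real_of_int (a' $ i) = r * real_of_int (a $ i)" for i by (simp add: a'_def fl)
  have "A *v a' = 0"
  proof (rule vec_eq_iff[THEN iffD2, rule_format])
    fix k
    have "real_of_int ((A *v a') $ k) = r * real_of_int ((A *v a) $ k)"
      by (simp add: matrix_vector_mult_def a' sum_distrib_left mult_ac)
    then show "(A *v a') $ k = 0 $ k" using a by (simp add: minimal_dependency_def)
  qed
  moreover have "sgn (a' $ i) = sgn (a $ i)" for i
  proof -
    have "sgn (real_of_int (a' $ i)) = sgn (real_of_int (a $ i))" using r by (simp add: a' sgn_mult)
    then show ?thesis by (auto simp: sgn_if split: if_splits)
  qed
  moreover have "\<bar>a' $ i\<bar> \<le> \<bar>a $ i\<bar>" for i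
  proof -
    have "\<bar>real_of_int (a' $ i)\<bar> \<le> \<bar>real_of_int (a $ i)\<bar>"
      using r by (simp add: a' abs_mult mult_left_le_one_le)
    then show ?thesis by linarith
  qed
  moreover have "a' \<noteq> a"
  proof
    assume "a' = a"
    then have "a $ i = 0" for i using a'[of i] r by simp
    then have "a = 0" by (simp add: vec_eq_iff)
    then show False using a by (simp add: minimal_dependency_def)
  qed
  ultimately show False using a unfolding minimal_dependency_def by blast
qed

text \<open>By rank and nullity the real kernel is a line, and \<open>a\<close> is a nonzero vector
  on it.\<close>

lemma corank_one_kernel:
  fixes A :: "int ^ 's ^ 'm" and x :: "real ^ 's"
  assumes rank: "int (rank (map_matrix real_of_int A)) = int CARD('s) - 1"
    and a: "A *v a = 0" "a \<noteq> 0" and x: "map_matrix real_of_int A *v x = 0"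
  shows "\<exists>t. \<forall>i. x $ i = t * real_of_int (a $ i)"
proof -
  define r :: "real ^ 's" where "r = (\<chi> i. real_of_int (a $ i))"
  let ?A = "map_matrix real_of_int A"
  have "?A *v r = 0"
  proof (rule vec_eq_iff[THEN iffD2, rule_format])
    fix k
    have "(?A *v r) $ k = real_of_int ((A *v a) $ k)"
      by (simp add: matrix_vector_mult_def r_def map_matrix_def)
    then show "(?A *v r) $ k = 0 $ k" by (simp add: a)
  qed
  have "r \<noteq> 0" using a(2) by (simp add: r_def vec_eq_iff)
  have sub: "subspace {x. ?A *v x = 0}"
    by (auto simp: subspace_def matrix_vector_right_distrib matrix_vector_mult_scaleR)
  have "span {r} = {x. ?A *v x = 0}"
  proof (rule subspace_dim_equal)
    show "span {r} \<subseteq> {x. ?A *v x = 0}"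
      using \<open>?A *v r = 0\<close> sub by (intro span_minimal) auto
    have "dim {x. ?A *v x = 0} = 1" using dim_null_space[of ?A] rank by linarith
    then show "dim {x. ?A *v x = 0} \<le> dim (span {r})" using \<open>r \<noteq> 0\<close> by simp
  qed (use sub in auto)
  then have "x \<in> span {r}" using x by blast
  then obtain t where "x = t *\<^sub>R r" by (auto simp: span_singleton)
  then show ?thesis by (auto simp: r_def)
qed

section \<open>From the polytope to the combinatorics of the dependency\<close>

text \<open>The hypotheses of \<open>circuit_no_decomposition\<close> are derived for the
  sign-changed columns: decomposition from unimodularity and saturation, the crossing condition from
  the simplicial complex.\<close>

lemma no_unimodular_triangulation:
  fixes A :: "int ^ 's ^ 'm" and a :: "int ^ 's"
  assumes sat: "saturated A"
    and rank: "int (rank (map_matrix real_of_int A)) = int CARD('s) - 1"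
    and a: "minimal_dependency A a"
    and even: "even (\<Sum>j\<in>UNIV. a $ j)"
    and big: "\<bar>a $ j\<bar> > 1"
    and T: "unimodular_triangulation_of T (sym_polytope A)"
  shows False
proof -
  let ?P = "sym_polytope A" and ?A = "map_matrix real_of_int A"
  \<comment> \<open>Zero entries of \<open>a\<close> get sign 1, so every \<open>v i\<close> is a
    column of \<open>A\<close> or its negative, also outside the support of
    \<open>a\<close>.\<close>
  define s :: "'s \<Rightarrow> int" where "s = (\<lambda>i. if a $ i < 0 then -1 else 1)"
  define v where "v = (\<lambda>i. real_of_int (s i) *\<^sub>R column i ?A)"
  define b where "b = (\<lambda>i. \<bar>a $ i\<bar>)"
  have sb: "s i * b i = a $ i" for i by (auto simp: s_def b_def)
  have Aa: "A *v a = 0" "a \<noteq> 0" using a by (auto simp: minimal_dependency_def)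
  have lin: "(\<Sum>i\<in>UNIV. c i *\<^sub>R v i) = ?A *v (\<chi> i. real_of_int (s i) * c i)" for c
    by (simp add: matrix_mult_sum v_def scalar_mult_eq_scaleR mult.commute)
  have ker: "\<exists>t. \<forall>i. c i = t * real_of_int (b i)" if "(\<Sum>i\<in>UNIV. c i *\<^sub>R v i) = 0" for c
  proof -
    have "\<exists>t. \<forall>i. real_of_int (s i) * c i = t * real_of_int (a $ i)"
      using corank_one_kernel[OF rank Aa that[unfolded lin]] by simp
    then obtain t where t: "\<And>i. real_of_int (s i) * c i = t * real_of_int (a $ i)" by blast
    have "c i = t * real_of_int (b i)" for i using t[of i] by (auto simp: s_def b_def abs_if split: if_splits)
    then show ?thesis by blast
  qed
  have dep: "(\<Sum>i\<in>UNIV. real_of_int (b i) *\<^sub>R v i) = 0"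
  proof -
    have "?A *v (\<chi> i. real_of_int (a $ i)) = 0"
    proof (rule vec_eq_iff[THEN iffD2, rule_format])
      fix k
      have "(?A *v (\<chi> i. real_of_int (a $ i))) $ k = real_of_int ((A *v a) $ k)"
        by (simp add: matrix_vector_mult_def map_matrix_def)
      then show "(?A *v (\<chi> i. real_of_int (a $ i))) $ k = 0 $ k" by (simp add: Aa)
    qed
    then show ?thesis unfolding lin by (simp add: sb flip: of_int_mult)
  qed
  have prim: "t \<in> \<int>" if "\<And>i. t * real_of_int (b i) \<in> \<int>" for t :: real
  proof (rule minimal_dependency_primitive[OF a])
    fix i
    have "t * real_of_int (a $ i) = of_int (s i) * (t * real_of_int (b i))"
      by (simp flip: sb[of i])
    also have "\<dots> \<in> \<int>" by (rule Ints_mult[OF Ints_of_int that])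
    finally show "t * real_of_int (a $ i) \<in> \<int>" .
  qed
  have evenb: "even (sum b UNIV)"
  proof -
    \<comment> \<open>Each term is 0 or \<open>- 2 * a $ i\<close>.\<close>
    have "even (\<Sum>i\<in>UNIV. \<bar>a $ i\<bar> - a $ i)" by (intro dvd_sum) (simp add: abs_if)
    then show ?thesis using even by (simp add: sum_subtractf b_def)
  qed
  have bj: "b j \<ge> 2" using big by (simp add: b_def)
  \<comment> \<open>Saturation says nothing about the origin, so zero columns are excluded by the
    kernel: a unit vector in it would be an integer multiple of \<open>b\<close>, which has the
    entry \<open>b j \<ge> 2\<close>.\<close>
  have v0: "v i \<noteq> 0" for i
  proof
    assume "v i = 0"
    then have "(\<Sum>l\<in>UNIV. (if l = i then 1 else 0) *\<^sub>R v l) = 0"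
      by (simp add: if_distrib[of "\<lambda>c. c *\<^sub>R _"] cong: if_cong)
    from ker[OF this] obtain t where t: "\<And>l. (if l = i then 1 else 0) = t * real_of_int (b l)" by blast
    have "t \<in> \<int>" by (rule prim) (simp flip: t)
    then obtain z where z: "t = of_int z" by (rule Ints_cases)
    have "t \<noteq> 0" using t[of i] by auto
    then have "j = i" using t[of j] bj by (auto split: if_splits)
    then have "real_of_int (z * b j) = 1" using t[of j] z by simp
    then have "z * b j = 1" using of_int_eq_1_iff by blast
    then show False using bj by (simp add: zmult_eq_1_iff)
  qed
  have colL: "column (Inl i) (sym_matrix A) = column i ?A"
    and colR: "column (Inr i) (sym_matrix A) = - column i ?A" for i
    by (auto simp: column_def sym_matrix_def vec_eq_iff map_matrix_def)
  define pos where "pos = (\<lambda>i. if a $ i < 0 then Inr i else Inl i :: 's + 's)"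
  define neg where "neg = (\<lambda>i. if a $ i < 0 then Inl i else Inr i :: 's + 's)"
  have vpos: "column (pos i) (sym_matrix A) = v i" and vneg: "column (neg i) (sym_matrix A) = - v i" for i
    by (auto simp: pos_def neg_def colL colR v_def s_def)
  have colcase: "\<exists>i. column k (sym_matrix A) = v i \<or> column k (sym_matrix A) = - v i" for k
    by (cases k) (auto simp: colL colR v_def s_def)
  have colP: "column k (sym_matrix A) \<in> ?P" for k
    unfolding sym_polytope_def by (rule hull_inc) (auto simp: columns_def)
  have colZ: "column k (sym_matrix A) \<in> int_lattice" for k
    by (cases k) (auto simp: int_lattice_def column_def sym_matrix_def)
  have vP: "v i \<in> ?P" "- v i \<in> ?P" and vZ: "v i \<in> int_lattice" for i
    using colP[of "pos i"] colP[of "neg i"] colZ[of "pos i"] by (simp_all add: vpos vneg)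
  have inj: "k = l" if "column k (sym_matrix A) = column l (sym_matrix A)" for k l
  proof -
    have "column k (sym_matrix A) \<noteq> 0" using colcase[of k] v0 by auto
    then have "\<exists>!k'. column k' (sym_matrix A) = column k (sym_matrix A)"
      using sat colP colZ unfolding saturated_def by blast
    then show ?thesis using that by metis
  qed
  have vinj: "v i = v l \<longleftrightarrow> i = l" for i l
    using inj[of "pos i" "pos l", unfolded vpos] by (auto simp: pos_def split: if_splits)
  have vneq: "v i \<noteq> - v l" for i l
    using inj[of "pos i" "neg l", unfolded vpos vneg] by (auto simp: pos_def neg_def split: if_splits)
  have conv: "convex ?P" by (simp add: sym_polytope_def)
  have zero: "0 \<in> ?P"
    using convexD[OF conv vP(1)[of j] vP(2)[of j], of "1/2" "1/2"] by simp
  have points: "y = 0 \<or> (\<exists>i. y = v i \<or> y = - v i)" if "y \<in> ?P \<inter> int_lattice" for y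
    using sat that colcase unfolding saturated_def by metis
  define Vs where "Vs = {C. convex hull C \<in> T \<and> \<not> affine_dependent C}"
  show False
  proof (rule circuit_no_decomposition[OF ker dep _ prim evenb bj, where Vs = Vs])
    show "0 \<le> b i" for i by (simp add: b_def)
    show "\<exists>V\<in>Vs. \<exists>d. (\<Sum>i\<in>UNIV. real_of_int (d i) *\<^sub>R v i) = (\<Sum>i\<in>UNIV. real_of_int (c i) *\<^sub>R v i) \<and>
          (\<Sum>i\<in>UNIV. \<bar>d i\<bar>) \<le> int n \<and> (\<forall>i. d i > 0 \<longrightarrow> v i \<in> V) \<and> (\<forall>i. d i < 0 \<longrightarrow> - v i \<in> V)"
      if n: "n \<ge> 1" and eq: "(\<Sum>i\<in>UNIV. real_of_int (c i) *\<^sub>R v i) = (\<Sum>i\<in>UNIV. c' i *\<^sub>R v i)"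
        and le: "(\<Sum>i\<in>UNIV. \<bar>c' i\<bar>) \<le> real n" for n c c'
    proof -
      define x where "x = (\<Sum>i\<in>UNIV. real_of_int (c i) *\<^sub>R v i)"
      have xZ: "x \<in> int_lattice"
        using vZ by (auto simp: x_def int_lattice_def)
      \<comment> \<open>The signs move into the points, which leaves nonnegative weights of sum at
        most 1; the origin of the polytope takes the rest.\<close>
      have "(1 / real n) *\<^sub>R x = (\<Sum>i\<in>UNIV. (\<bar>c' i\<bar> / real n) *\<^sub>R (sgn (c' i) *\<^sub>R v i))"
        by (simp add: x_def eq scaleR_sum_right abs_mult_sgn)
      also have "\<dots> \<in> ?P"
      proof (rule convex_sum_with_zero[OF conv zero])
        show "sgn (c' i) *\<^sub>R v i \<in> ?P" for i using vP[of i] zero by (auto simp: sgn_if)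
        show "(\<Sum>i\<in>UNIV. \<bar>c' i\<bar> / real n) \<le> 1" using le n by (simp flip: sum_divide_distrib)
      qed auto
      finally have xP: "(1 / real n) *\<^sub>R x \<in> ?P" .
      obtain C m where C: "convex hull C \<in> T" "\<not> affine_dependent C" "C \<subseteq> ?P \<inter> int_lattice"
        and m: "\<forall>y\<in>C. 0 \<le> (m y :: int)" "sum m C = int n" "(\<Sum>y\<in>C. of_int (m y) *\<^sub>R y) = x"
        by (rule unimodular_triangulation_integral_decomposition[OF T conv zero n xZ xP]) (rule that)
      define m' where "m' = (\<lambda>y. if y \<in> C then m y else 0)"
      \<comment> \<open>Multiplicities at opposite points cancel, which can only lower the norm, and
        a nonzero difference shows which of the two points lies in \<open>C\<close>. Copies of the
        origin count towards \<open>n\<close> but not towards \<open>x\<close>.\<close>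
      define d where "d = (\<lambda>i. m' (v i) - m' (- v i))"
      have m'0: "0 \<le> m' y" for y using m(1) by (simp add: m'_def)
      \<comment> \<open>By saturation \<open>C\<close> consists of points 0, \<open>v i\<close> and
        \<open>- v i\<close>. These are pairwise different, so a sum over \<open>C\<close>, extended
        by zero, splits without double counting; it is applied to vectors and to
        multiplicities.\<close>
      have split: "(\<Sum>y\<in>C. h y) = h' 0 + ((\<Sum>i\<in>UNIV. h' (v i)) + (\<Sum>i\<in>UNIV. h' (- v i)))"
        if h: "\<And>y. h' y = (if y \<in> C then h y else 0)" for h h' :: "real ^ 'm \<Rightarrow> 'b::comm_monoid_add"
      proof -
        let ?X = "insert 0 (range v \<union> range (\<lambda>i. - v i))"
        have CX: "C \<subseteq> ?X"
        proof
          fix y assume "y \<in> C"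
          then have "y = 0 \<or> (\<exists>i. y = v i \<or> y = - v i)" using points C(3) by blast
          then show "y \<in> ?X" by auto
        qed
        have "(\<Sum>y\<in>C. h y) = (\<Sum>y\<in>C. h' y)" using h by simp
        also have "\<dots> = (\<Sum>y\<in>?X. h' y)"
          using CX h by (intro sum.mono_neutral_left) auto
        also have "\<dots> = h' 0 + (\<Sum>y\<in>range v \<union> range (\<lambda>i. - v i). h' y)"
          using v0 by (intro sum.insert) (auto simp: eq_commute[of 0])
        also have "(\<Sum>y\<in>range v \<union> range (\<lambda>i. - v i). h' y) = (\<Sum>y\<in>range v. h' y) + (\<Sum>y\<in>range (\<lambda>i. - v i). h' y)"
          using vneq by (intro sum.union_disjoint) auto
        also have "(\<Sum>y\<in>range v. h' y) = (\<Sum>i\<in>UNIV. h' (v i))"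
          by (subst sum.reindex) (auto simp: inj_on_def vinj)
        also have "(\<Sum>y\<in>range (\<lambda>i. - v i). h' y) = (\<Sum>i\<in>UNIV. h' (- v i))"
          by (subst sum.reindex) (auto simp: inj_on_def vinj)
        finally show ?thesis .
      qed
      have "(\<Sum>y\<in>C. of_int (m y) *\<^sub>R y) = (\<Sum>i\<in>UNIV. real_of_int (d i) *\<^sub>R v i)"
        by (subst split[of "\<lambda>y. of_int (m' y) *\<^sub>R y"])
          (auto simp: m'_def d_def algebra_simps simp flip: sum.distrib sum_subtractf intro!: sum.cong)
      moreover have "(\<Sum>i\<in>UNIV. \<bar>d i\<bar>) \<le> (\<Sum>i\<in>UNIV. m' (v i) + m' (- v i))"
        using m'0 by (intro sum_mono) (simp add: d_def abs_le_iff add_increasing add_increasing2)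
      moreover have "sum m C = m' 0 + ((\<Sum>i\<in>UNIV. m' (v i)) + (\<Sum>i\<in>UNIV. m' (- v i)))"
        by (rule split) (simp add: m'_def)
      moreover have "v i \<in> C" if "d i > 0" for i
        using that m'0[of "- v i"] by (auto simp: d_def m'_def split: if_splits)
      moreover have "- v i \<in> C" if "d i < 0" for i
        using that m'0[of "v i"] by (auto simp: d_def m'_def split: if_splits)
      ultimately show ?thesis
        using C m m'0[of 0] by (intro bexI[of _ C] exI[of _ d]) (auto simp: Vs_def x_def sum.distrib)
    qed
    show False
      if V: "V \<in> Vs" and W: "W \<in> Vs" and c0: "\<And>i. 0 \<le> (c i :: int)" and e0: "\<And>i. 0 \<le> (e i :: int)"
        and cV: "\<And>i. c i > 0 \<Longrightarrow> v i \<in> V" and eW: "\<And>i. e i > 0 \<Longrightarrow> - v i \<in> W"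
        and ce: "sum c UNIV = sum e UNIV" and k: "sum c UNIV > 0"
        and eq: "(\<Sum>i\<in>UNIV. real_of_int (c i) *\<^sub>R v i) = - (\<Sum>i\<in>UNIV. real_of_int (e i) *\<^sub>R v i)"
      for V W c e
    proof -
      define k where "k = real_of_int (sum c UNIV)"
      have k0: "k > 0" using \<open>sum c UNIV > 0\<close> by (simp add: k_def del: of_int_sum)
      \<comment> \<open>Dividing by the common sum \<open>k\<close> turns both sides of the relation
        into convex combinations with positive weights on \<open>?F\<close> and \<open>?G\<close>;
        inverting \<open>v\<close> transfers the weights from indices to points.\<close>
      define \<alpha> where "\<alpha> = (\<lambda>y. real_of_int (c (inv_into UNIV v y)) / k)"
      define \<beta> where "\<beta> = (\<lambda>y. real_of_int (e (inv_into UNIV v (- y))) / k)"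
      have "inj v" by (simp add: inj_def vinj)
      then have \<alpha>v: "\<alpha> (v i) = real_of_int (c i) / k" and \<beta>v: "\<beta> (- v i) = real_of_int (e i) / k" for i
        by (simp_all add: \<alpha>_def \<beta>_def)
      let ?F = "v ` {i. c i > 0}" and ?G = "(\<lambda>i. - v i) ` {i. e i > 0}"
      have sumF: "sum g ?F = (\<Sum>i\<in>UNIV. g' i)" if "\<And>i. c i > 0 \<Longrightarrow> g' i = g (v i)" "\<And>i. c i = 0 \<Longrightarrow> g' i = 0"
        for g :: "real ^ 'm \<Rightarrow> 'b::comm_monoid_add" and g'
      proof -
        have "sum g ?F = (\<Sum>i | c i > 0. g' i)"
          using that(1) by (subst sum.reindex) (auto simp: inj_on_def vinj)
        also have "\<dots> = (\<Sum>i\<in>UNIV. g' i)"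
          using that(2) c0 by (intro sum.mono_neutral_left) (auto simp: order_less_le)
        finally show ?thesis .
      qed
      have sumG: "sum g ?G = (\<Sum>i\<in>UNIV. g' i)" if "\<And>i. e i > 0 \<Longrightarrow> g' i = g (- v i)" "\<And>i. e i = 0 \<Longrightarrow> g' i = 0"
        for g :: "real ^ 'm \<Rightarrow> 'b::comm_monoid_add" and g'
      proof -
        have "sum g ?G = (\<Sum>i | e i > 0. g' i)"
          using that(1) by (subst sum.reindex) (auto simp: inj_on_def vinj)
        also have "\<dots> = (\<Sum>i\<in>UNIV. g' i)"
          using that(2) e0 by (intro sum.mono_neutral_left) (auto simp: order_less_le)
        finally show ?thesis .
      qed
      have "?F \<inter> ?G \<noteq> {}"
      proof (rule simplicial_complex_unique_combination[of T V W ?F \<alpha> ?G \<beta>])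
        show "simplicial_complex T"
          using T by (simp add: unimodular_triangulation_of_def triangulation_of_def)
        show "sum \<alpha> ?F = 1"
          using k0 by (subst sumF[of "\<lambda>i. real_of_int (c i) / k"]) (auto simp: \<alpha>v k_def simp flip: sum_divide_distrib)
        show "sum \<beta> ?G = 1"
          using k0 by (subst sumG[of "\<lambda>i. real_of_int (e i) / k"]) (auto simp: \<beta>v k_def ce simp flip: sum_divide_distrib)
        have "(\<Sum>x\<in>?F. \<alpha> x *\<^sub>R x) = (\<Sum>i\<in>UNIV. (real_of_int (c i) / k) *\<^sub>R v i)"
          by (rule sumF) (auto simp: \<alpha>v)
        also have "\<dots> = (1 / k) *\<^sub>R (\<Sum>i\<in>UNIV. real_of_int (c i) *\<^sub>R v i)"
          by (simp add: scaleR_sum_right)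
        also have "\<dots> = (\<Sum>i\<in>UNIV. (real_of_int (e i) / k) *\<^sub>R (- v i))"
          unfolding eq by (simp add: scaleR_sum_right sum_negf)
        also have "\<dots> = (\<Sum>x\<in>?G. \<beta> x *\<^sub>R x)"
          by (rule sumG[symmetric]) (auto simp: \<beta>v)
        finally show "(\<Sum>x\<in>?F. \<alpha> x *\<^sub>R x) = (\<Sum>x\<in>?G. \<beta> x *\<^sub>R x)" .
      qed (use V W cV eW k0 in \<open>auto simp: Vs_def \<alpha>v \<beta>v\<close>)
      \<comment> \<open>A common vertex would be \<open>v i = - v l\<close> for some
        \<open>i\<close> and \<open>l\<close>.\<close>
      then show False using vneq by auto
    qed
  qed
qed

theorem theorem4p4:
  fixes A :: "int ^ 's ^ 'm" and a :: "int ^ 's"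
  assumes "saturated A"
    and "int (rank (map_matrix real_of_int A)) = int CARD('s) - 1"
    and "minimal_dependency A a"
    and "\<forall>b. minimal_dependency A b \<longrightarrow> b = a \<or> b = - a"
    and "even (\<Sum>j\<in>UNIV. a $ j)"
    and "\<exists>j. \<bar>a $ j\<bar> > 1"
  shows "\<not> (\<exists>T. regular_triangulation_of T (sym_polytope A) \<and>
               unimodular_triangulation_of T (sym_polytope A) \<and>
               complex_vertices T \<subseteq> sym_polytope A \<inter> int_lattice)"
  using assms no_unimodular_triangulation by blast

end
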